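(* For every $0<\delta<1$ and $\varepsilon>0$, and for all sufficiently large $n$ (in terms of $\delta$ and $\varepsilon$), every $n$-vertex triangle-free graph with minimum degree at least $\frac{1}{3}n-n^{1-\delta}$ has chromatic number at most $$10^{391}+1+\left\lceil\frac{(1+\varepsilon)(1-\delta)}{\delta}\right\rceil.$$
   Context: All graphs are finite and simple. *)

theory Defs
  imports Complex_Main "Graph_Theory.Pair_Digraph"
begin

text \<open>
  Finite simple graphs are values of \<^typ>\<open>'a pair_pre_digraph\<close> satisfying \<^const>\<open>pair_graph\<close>:
  an undirected edge \<open>uv\<close> is represented by the two arcs \<open>(u, v)\<close> and \<open>(v, u)\<close>, so the
  out-degree of a vertex is its degree as a vertex of the undirected graph.
\<close>

definition min_degree :: "'a pair_pre_digraph \<Rightarrow> nat" where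
  "min_degree G = Min (out_degree (with_proj G) ` pverts G)"

text \<open>In a loopfree graph the three vertices below are automatically distinct.\<close>

definition triangle_free :: "'a pair_pre_digraph \<Rightarrow> bool" where
  "triangle_free G \<longleftrightarrow>
     \<not> (\<exists>u v w. (u, v) \<in> parcs G \<and> (v, w) \<in> parcs G \<and> (w, u) \<in> parcs G)"

definition proper_colouring :: "'a pair_pre_digraph \<Rightarrow> nat \<Rightarrow> ('a \<Rightarrow> nat) \<Rightarrow> bool" where
  "proper_colouring G k c \<longleftrightarrow>
     (\<forall>v \<in> pverts G. c v < k) \<and> (\<forall>u v. (u, v) \<in> parcs G \<longrightarrow> c u \<noteq> c v)"

definition chromatic_number :: "'a pair_pre_digraph \<Rightarrow> nat" where
  "chromatic_number G = (LEAST k. \<exists>c. proper_colouring G k c)"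

text \<open>The minimum in the definition of the chromatic number is attained for finite simple graphs.\<close>

lemma proper_colouring_chromatic_number:
  assumes "pair_graph G"
  shows "\<exists>c. proper_colouring G (chromatic_number G) c"
proof -
  interpret pair_graph G by fact
  obtain c where c: "bij_betw c (pverts G) {0..<card (pverts G)}"
    using ex_bij_betw_finite_nat pair_finite_verts by blast
  have "c u \<noteq> c v" if "(u, v) \<in> parcs G" for u v
  proof -
    have "u \<in> pverts G" "v \<in> pverts G"
      using in_arcsD1 in_arcsD2 that by auto
    moreover have "u \<noteq> v"
      using pair_no_loops[OF that] by simp
    ultimately show ?thesis
      using c by (auto simp: bij_betw_def inj_on_def)
  qed
  moreover have "c v < card (pverts G)" if "v \<in> pverts G" for v
    using bij_betwE[OF c] that by auto
  ultimately have "\<exists>c. proper_colouring G (card (pverts G)) c"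
    unfolding proper_colouring_def by blast
  then show ?thesis
    unfolding chromatic_number_def by (rule LeastI)
qed

end

theory Submission
  imports Defs "HOL-Library.Indicator_Function" "HOL-Analysis.Convex" "HOL-Real_Asymp.Real_Asymp"
begin

text \<open>
  Let \<open>d\<close> be about \<open>n / 3\<close> and \<open>s = n - 3 d\<close>, of order \<open>n powr (1 - \<delta>)\<close>. If the graph is not
  colourable with \<open>41 ^ 238\<close> colours, there is an edge \<open>uv\<close> with few edges between its two
  neighbourhoods: otherwise one finds 238 edges such that the differences of the indicators of
  the neighbourhoods of their ends are almost orthogonal, although all of them correlate with the adjacency matrix, contradicting
  Cauchy--Schwarz. From such an edge one gets an independent set \<open>B\<close> of size about \<open>2 n / 3\<close>, a second
  independent set \<open>C\<close> (the vertices adjacent to most of \<open>B\<close>), and a rest \<open>A\<close> of size \<open>O(s)\<close> in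
  which adjacent vertices have almost complementary neighbourhoods in \<open>B\<close>, up to \<open>O(s)\<close> elements. The
  last property forbids odd closed walks in \<open>A\<close> shorter than a constant times \<open>n powr \<delta>\<close>. Therefore
  balls of that radius in \<open>A\<close> are bipartite, and region growing leaves, at the cost of one colour,
  only a fraction \<open>n powr (- \<beta>)\<close> of \<open>A\<close>, for \<open>\<beta>\<close> slightly smaller than \<open>\<delta>\<close>.
\<close>

section \<open>Almost orthogonal vectors\<close>

text \<open>Let \<open>K\<close> be the sum of the rank-one matrices \<open>D i x * D i y\<close>.
  Its entrywise inner product with \<open>W\<close> is at most \<open>- (m * c)\<close>, while its
  squared Frobenius norm is the sum of all squared inner products of the vectors \<open>D i\<close>.
  Cauchy--Schwarz compares the two.\<close>

lemma almost_orthogonal_bound: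
  fixes D :: "nat \<Rightarrow> 'a \<Rightarrow> real" and W :: "'a \<Rightarrow> 'a \<Rightarrow> real"
  assumes neg: "\<And>i. i < m \<Longrightarrow> (\<Sum>x\<in>V. \<Sum>y\<in>V. D i x * D i y * W x y) \<le> - c"
    and "c \<ge> 0"
    and orth: "\<And>i j. i < m \<Longrightarrow> j < m \<Longrightarrow> (\<Sum>x\<in>V. D i x * D j x)\<^sup>2 \<le> (if i = j then a else 0) + b"
    and W: "\<And>x y. (W x y)\<^sup>2 \<le> 1 / 4"
  shows "(real m * c)\<^sup>2 \<le> (real m * a + (real m)\<^sup>2 * b) * ((real (card V))\<^sup>2 / 4)"
proof -
  define K where "K x y = (\<Sum>i<m. D i x * D i y)" for x y
  define I where "I = (\<Sum>x\<in>V. \<Sum>y\<in>V. K x y * W x y)"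
  have "I = (\<Sum>x\<in>V. \<Sum>i<m. \<Sum>y\<in>V. D i x * D i y * W x y)"
    unfolding I_def K_def sum_distrib_right
    by (intro sum.cong refl) (rule sum.swap)
  also have "\<dots> = (\<Sum>i<m. \<Sum>x\<in>V. \<Sum>y\<in>V. D i x * D i y * W x y)"
    by (rule sum.swap)
  also have "\<dots> \<le> (\<Sum>i<m. - c)"
    using neg by (intro sum_mono) auto
  finally have "real m * c \<le> - I" by simp
  then have "(real m * c)\<^sup>2 \<le> (- I)\<^sup>2"
    using \<open>c \<ge> 0\<close> by (intro power_mono) auto
  also have "\<dots> = (\<Sum>p\<in>V \<times> V. K (fst p) (snd p) * W (fst p) (snd p))\<^sup>2"
    unfolding I_def by (simp add: sum.cartesian_product case_prod_beta)
  also have "\<dots> \<le> (\<Sum>p\<in>V \<times> V. (K (fst p) (snd p))\<^sup>2) * (\<Sum>p\<in>V \<times> V. (W (fst p) (snd p))\<^sup>2)"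
    by (rule Cauchy_Schwarz_ineq_sum)
  also have "\<dots> \<le> (real m * a + (real m)\<^sup>2 * b) * ((real (card V))\<^sup>2 / 4)"
  proof (rule mult_mono)
    have "(\<Sum>p\<in>V \<times> V. (W (fst p) (snd p))\<^sup>2) \<le> (\<Sum>p\<in>V \<times> V. 1 / 4)"
      by (intro sum_mono W)
    then show "(\<Sum>p\<in>V \<times> V. (W (fst p) (snd p))\<^sup>2) \<le> (real (card V))\<^sup>2 / 4"
      by (simp add: card_cartesian_product power2_eq_square)
    have "(\<Sum>p\<in>V \<times> V. (K (fst p) (snd p))\<^sup>2) = (\<Sum>p\<in>V \<times> V. \<Sum>i<m. \<Sum>j<m.
        (D i (fst p) * D j (fst p)) * (D i (snd p) * D j (snd p)))"
      unfolding K_def power2_eq_square sum_product by (intro sum.cong refl) (simp add: mult_ac)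
    also have "\<dots> = (\<Sum>i<m. \<Sum>p\<in>V \<times> V. \<Sum>j<m.
        (D i (fst p) * D j (fst p)) * (D i (snd p) * D j (snd p)))"
      by (rule sum.swap)
    also have "\<dots> = (\<Sum>i<m. \<Sum>j<m. \<Sum>p\<in>V \<times> V.
        (D i (fst p) * D j (fst p)) * (D i (snd p) * D j (snd p)))"
      by (intro sum.cong refl) (rule sum.swap)
    also have "\<dots> = (\<Sum>i<m. \<Sum>j<m. (\<Sum>x\<in>V. D i x * D j x)\<^sup>2)"
      unfolding power2_eq_square sum_product by (simp add: sum.cartesian_product case_prod_beta)
    also have "\<dots> \<le> (\<Sum>i<m. \<Sum>j<m. (if i = j then a else 0) + b)"
      using orth by (intro sum_mono) auto
    also have "\<dots> = (\<Sum>i<m. a + real m * b)"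
      by (intro sum.cong refl) (simp add: sum.distrib)
    also have "\<dots> = real m * a + (real m)\<^sup>2 * b"
      by (simp add: algebra_simps power2_eq_square)
    finally show "(\<Sum>p\<in>V \<times> V. (K (fst p) (snd p))\<^sup>2) \<le> real m * a + (real m)\<^sup>2 * b" .
    then show "0 \<le> real m * a + (real m)\<^sup>2 * b"
      by (rule order.trans[rotated]) (simp add: sum_nonneg)
  qed (simp add: sum_nonneg)
  finally show ?thesis .
qed

section \<open>Colourings of triangle-free graphs given by neighbourhoods\<close>

text \<open>Triangle-freeness is encoded as disjointness of the neighbourhoods of adjacent vertices.
  This also excludes loops, since \<open>v \<in> N v\<close> would force \<open>N v\<close> to be
  empty.\<close>

locale triangle_free_graph =
  fixes V :: "'a set" and N :: "'a \<Rightarrow> 'a set"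
  assumes finite_V: "finite V"
    and N_subset: "N v \<subseteq> V"
    and N_sym: "u \<in> N v \<Longrightarrow> v \<in> N u"
    and N_disjoint: "v \<in> N u \<Longrightarrow> N u \<inter> N v = {}"
begin

definition independent :: "'a set \<Rightarrow> bool" where
  "independent A \<longleftrightarrow> (\<forall>u\<in>A. \<forall>v\<in>A. v \<notin> N u)"

definition colourable :: "'a set \<Rightarrow> nat \<Rightarrow> bool" where
  "colourable A k \<longleftrightarrow>
     (\<exists>c::'a \<Rightarrow> nat. (\<forall>v\<in>A. c v < k) \<and> (\<forall>u\<in>A. \<forall>v\<in>A. v \<in> N u \<longrightarrow> c u \<noteq> c v))"

lemma finite_subset_V: "A \<subseteq> V \<Longrightarrow> finite A"
  by (rule finite_subset[OF _ finite_V])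

lemma finite_N [simp]: "finite (N v)"
  by (rule finite_subset_V[OF N_subset])

lemma mem_N_in_V: "v \<in> N u \<Longrightarrow> v \<in> V" "v \<in> N u \<Longrightarrow> u \<in> V"
  using N_subset N_sym by blast+

lemma independent_subset: "independent B \<Longrightarrow> A \<subseteq> B \<Longrightarrow> independent A"
  unfolding independent_def by blast

lemma colourable_subset: "colourable B k \<Longrightarrow> A \<subseteq> B \<Longrightarrow> colourable A k"
  unfolding colourable_def by blast

lemma colourable_mono: "colourable A k \<Longrightarrow> k \<le> l \<Longrightarrow> colourable A l"
  unfolding colourable_def using order.strict_trans2[of _ k l] by blast

lemma colourable_independent: "independent A \<Longrightarrow> colourable A 1"
  unfolding colourable_def independent_def by (intro exI[of _ "\<lambda>_. 0"]) auto

lemma colourable_Un: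
  assumes "colourable A k" "colourable B l"
  shows "colourable (A \<union> B) (k + l)"
proof -
  obtain c where c: "\<And>v. v \<in> A \<Longrightarrow> c v < k"
    "\<And>u v. u \<in> A \<Longrightarrow> v \<in> A \<Longrightarrow> v \<in> N u \<Longrightarrow> c u \<noteq> c v"
    using assms(1) unfolding colourable_def by blast
  obtain d where d: "\<And>v. v \<in> B \<Longrightarrow> d v < l"
    "\<And>u v. u \<in> B \<Longrightarrow> v \<in> B \<Longrightarrow> v \<in> N u \<Longrightarrow> d u \<noteq> d v"
    using assms(2) unfolding colourable_def by blast
  define e where "e v = (if v \<in> A then c v else k + d v)" for v
  have "e v < k + l" if "v \<in> A \<union> B" for v
    using c(1)[of v] d(1)[of v] that by (auto simp: e_def)
  moreover have "e u \<noteq> e v" if "u \<in> A \<union> B" "v \<in> A \<union> B" "v \<in> N u" for u v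
    using c(1)[of u] c(1)[of v] c(2)[of u v] d(2)[of u v] that by (auto simp: e_def)
  ultimately show ?thesis
    unfolding colourable_def by blast
qed

lemma colourable_Union_independent:
  assumes "finite I" "\<And>i. i \<in> I \<Longrightarrow> independent (M i)"
  shows "colourable (\<Union>i\<in>I. M i) (card I)"
  using assms
proof (induction I rule: finite_induct)
  case empty
  then show ?case by (simp add: colourable_def)
next
  case (insert i I)
  then have "colourable (M i \<union> (\<Union>i\<in>I. M i)) (1 + card I)"
    by (intro colourable_Un colourable_independent) auto
  then show ?case
    using insert by simp
qed

text \<open>Lets lists of rounded inner products serve as colours.\<close>

lemma colourable_by_labels:
  assumes "finite X" "\<And>v. v \<in> A \<Longrightarrow> g v \<in> X"
    and "\<And>u v. u \<in> A \<Longrightarrow> v \<in> A \<Longrightarrow> v \<in> N u \<Longrightarrow> g u \<noteq> g v"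
  shows "colourable A (card X)"
proof -
  obtain h where h: "bij_betw h X {0..<card X}"
    using assms(1) ex_bij_betw_finite_nat by blast
  have "\<forall>v\<in>A. h (g v) < card X"
    using bij_betwE[OF h] assms(2) by auto
  moreover have "\<forall>u\<in>A. \<forall>v\<in>A. v \<in> N u \<longrightarrow> h (g u) \<noteq> h (g v)"
    using h assms(2,3) unfolding bij_betw_def inj_on_def by blast
  ultimately show ?thesis
    unfolding colourable_def by (intro exI[of _ "h \<circ> g"]) auto
qed

definition majority :: "'a set \<Rightarrow> 'a set" where
  "majority Y = {u \<in> V. card (N u \<inter> Y) * 2 > card Y}"

text \<open>Adjacent vertices have disjoint neighbourhoods, so they cannot both see more than half
  of \<open>Y\<close>. This is the main source of independent sets below.\<close>

lemma independent_majority: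
  assumes "finite Y"
  shows "independent (majority Y)"
  unfolding independent_def
proof (intro ballI notI)
  fix u v assume uv: "u \<in> majority Y" "v \<in> majority Y" "v \<in> N u"
  have "card (N u \<inter> Y) + card (N v \<inter> Y) = card ((N u \<inter> Y) \<union> (N v \<inter> Y))"
    using N_disjoint[OF uv(3)] by (subst card_Un_disjoint) auto
  also have "\<dots> \<le> card Y"
    using assms by (intro card_mono) auto
  finally show False
    using uv(1,2) by (simp add: majority_def)
qed

section \<open>Region growing\<close>

definition nbhd :: "'a set \<Rightarrow> 'a set \<Rightarrow> 'a set" where
  "nbhd C X = (\<Union>x\<in>X. N x) \<inter> C"

text \<open>Walks from \<open>v\<close> of even length at most \<open>2 * i\<close>, staying in
  \<open>C\<close> after the start. Two steps are taken at once because the second nearly undoes the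
  complementation of neighbourhoods caused by the first.\<close>

primrec even_ball :: "'a set \<Rightarrow> 'a \<Rightarrow> nat \<Rightarrow> 'a set" where
  "even_ball C v 0 = {v}"
| "even_ball C v (Suc i) = even_ball C v i \<union> nbhd C (nbhd C (even_ball C v i))"

text \<open>For \<open>v \<in> C\<close> this is the ball of radius \<open>2 * i + 1\<close> around
  \<open>v\<close> in the graph induced on \<open>C\<close>.\<close>

definition ball_from :: "'a set \<Rightarrow> 'a \<Rightarrow> nat \<Rightarrow> 'a set" where
  "ball_from C v i = even_ball C v i \<union> nbhd C (even_ball C v i)"

lemma nbhd_subset: "nbhd C X \<subseteq> C"
  by (auto simp: nbhd_def)

lemma even_ball_subset: "v \<in> C \<Longrightarrow> even_ball C v i \<subseteq> C"
  by (induction i) (auto simp: nbhd_def)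

lemma ball_from_subset: "v \<in> C \<Longrightarrow> ball_from C v i \<subseteq> C"
  using even_ball_subset nbhd_subset unfolding ball_from_def by blast

text \<open>Otherwise \<open>t\<close> successive growths by more than the factor
  \<open>1 + y\<close>, starting from a nonempty ball, would exceed the size of
  \<open>C\<close>.\<close>

lemma exists_slow_growth:
  assumes "v \<in> C" "finite C" "y > 0" "(1 + y) ^ t > real (card C)"
  shows "\<exists>i<t. real (card (ball_from C v (Suc i))) \<le> (1 + y) * real (card (ball_from C v i))"
proof (rule ccontr)
  assume neg: "\<not> ?thesis"
  have "(1 + y) ^ i \<le> real (card (ball_from C v i))" if "i \<le> t" for i
    using that
  proof (induction i)
    case 0
    have "finite (ball_from C v 0)"
      using finite_subset[OF ball_from_subset[OF assms(1)] assms(2)] .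
    then have "card (ball_from C v 0) > 0"
      by (auto simp: card_gt_0_iff ball_from_def)
    then show ?case by simp
  next
    case (Suc i)
    then have "(1 + y) ^ Suc i \<le> (1 + y) * real (card (ball_from C v i))"
      using assms(3) by simp
    also have "\<dots> \<le> real (card (ball_from C v (Suc i)))"
      using neg Suc.prems by (auto simp: not_le intro: less_imp_le)
    finally show ?case .
  qed
  from this[of t] have "(1 + y) ^ t \<le> real (card (ball_from C v t))" by simp
  also have "\<dots> \<le> real (card C)"
    using card_mono[OF assms(2) ball_from_subset[OF assms(1)]] by simp
  finally show False using assms(4) by simp
qed

text \<open>The sets \<open>f x\<close> will be neighbourhoods in \<open>B\<close>. On a walk
  \<open>w, y, x\<close> the set \<open>f w\<close> avoids \<open>f y\<close>, so its elements
  outside \<open>f x\<close> are missed by both \<open>f y\<close> and \<open>f x\<close>; there are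
  at most \<open>E\<close> of them. Each double step therefore loses at most
  \<open>E\<close>.\<close>

lemma even_ball_close:
  assumes f: "\<And>x. x \<in> C \<Longrightarrow> f x \<subseteq> B" "finite B"
    and disj: "\<And>x y. x \<in> C \<Longrightarrow> y \<in> C \<Longrightarrow> y \<in> N x \<Longrightarrow> f x \<inter> f y = {}"
    and cover: "\<And>x y. x \<in> C \<Longrightarrow> y \<in> C \<Longrightarrow> y \<in> N x \<Longrightarrow> real (card (B - (f x \<union> f y))) \<le> E"
    and "E \<ge> 0" "v \<in> C" "x \<in> even_ball C v i"
  shows "real (card (f v - f x)) \<le> real i * E"
  using assms(7)
proof (induction i arbitrary: x)
  case 0
  then show ?case by simp
next
  case (Suc i)
  show ?case
  proof (cases "x \<in> even_ball C v i")
    case True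
    then have "real (card (f v - f x)) \<le> real i * E" by (rule Suc.IH)
    also have "\<dots> \<le> real (Suc i) * E"
      using assms(5) by (simp add: mult_right_mono)
    finally show ?thesis .
  next
    case False
    then have "x \<in> nbhd C (nbhd C (even_ball C v i))"
      using Suc.prems by simp
    then obtain w y where wy: "w \<in> even_ball C v i" "y \<in> C" "y \<in> N w" "x \<in> C" "x \<in> N y"
      by (auto simp: nbhd_def)
    then have "w \<in> C"
      using even_ball_subset[OF assms(6)] by blast
    have fin: "finite (f u)" if "u \<in> C" for u
      by (rule finite_subset[OF f(1)[OF that] f(2)])
    have sub: "f v - f x \<subseteq> (f v - f w) \<union> (B - (f y \<union> f x))"
      using disj[OF \<open>w \<in> C\<close> wy(2,3)] f(1)[OF \<open>w \<in> C\<close>] by blast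
    have "real (card (f v - f x)) \<le> real (card ((f v - f w) \<union> (B - (f y \<union> f x))))"
      using f(2) fin[OF assms(6)] by (intro of_nat_mono card_mono[OF _ sub]) auto
    also have "\<dots> \<le> real (card (f v - f w) + card (B - (f y \<union> f x)))"
      by (intro of_nat_mono card_Un_le)
    also have "\<dots> \<le> real i * E + E"
      using Suc.IH[OF wy(1)] cover[OF wy(2,4,5)] by simp
    finally show ?thesis
      by (simp add: algebra_simps)
  qed
qed

text \<open>A vertex \<open>z\<close> at an odd step has \<open>f z\<close> almost disjoint from
  \<open>f v\<close>, with at most \<open>i * E\<close> common elements. An edge \<open>xy\<close>
  between two such vertices would cover \<open>f v\<close> by these two intersections and the at
  most \<open>E\<close> elements outside \<open>f x\<close> and \<open>f y\<close>, too few for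
  \<open>big\<close>. So short odd closed walks through \<open>v\<close> do not exist.\<close>

lemma independent_nbhd_even_ball:
  assumes f: "\<And>x. x \<in> C \<Longrightarrow> f x \<subseteq> B" "finite B"
    and disj: "\<And>x y. x \<in> C \<Longrightarrow> y \<in> C \<Longrightarrow> y \<in> N x \<Longrightarrow> f x \<inter> f y = {}"
    and cover: "\<And>x y. x \<in> C \<Longrightarrow> y \<in> C \<Longrightarrow> y \<in> N x \<Longrightarrow> real (card (B - (f x \<union> f y))) \<le> E"
    and "E \<ge> 0" "v \<in> C" and big: "real (card (f v)) > real (2 * i + 1) * E"
  shows "independent (nbhd C (even_ball C v i))"
  unfolding independent_def
proof (intro ballI notI)
  fix x y assume xy: "x \<in> nbhd C (even_ball C v i)" "y \<in> nbhd C (even_ball C v i)" "y \<in> N x"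
  have fin: "finite (f u)" if "u \<in> C" for u
    by (rule finite_subset[OF f(1)[OF that] f(2)])
  have meet: "real (card (f v \<inter> f z)) \<le> real i * E" if z: "z \<in> nbhd C (even_ball C v i)" for z
  proof -
    obtain w where w: "w \<in> even_ball C v i" "z \<in> C" "z \<in> N w"
      using z by (auto simp: nbhd_def)
    then have "w \<in> C" using even_ball_subset[OF assms(6)] by blast
    have "real (card (f v \<inter> f z)) \<le> real (card (f v - f w))"
      using disj[OF \<open>w \<in> C\<close> w(2,3)] fin[OF assms(6)] by (intro of_nat_mono card_mono) auto
    also have "\<dots> \<le> real i * E"
      using even_ball_close[where f = f and B = B and E = E, OF assms(1-6) w(1)] by simp
    finally show ?thesis .
  qed
  have C: "x \<in> C" "y \<in> C" using xy nbhd_subset by blast+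
  have sub: "f v \<subseteq> (f v \<inter> f x) \<union> (f v \<inter> f y) \<union> (B - (f x \<union> f y))"
    using f(1)[OF assms(6)] by blast
  have "real (card (f v)) \<le> real (card ((f v \<inter> f x) \<union> (f v \<inter> f y) \<union> (B - (f x \<union> f y))))"
    using f(2) fin[OF assms(6)] by (intro of_nat_mono card_mono[OF _ sub]) auto
  also have "\<dots> \<le> real (card (f v \<inter> f x) + card (f v \<inter> f y) + card (B - (f x \<union> f y)))"
    by (intro of_nat_mono order.trans[OF card_Un_le] add_right_mono card_Un_le)
  also have "\<dots> \<le> real i * E + real i * E + E"
    using meet[OF xy(1)] meet[OF xy(2)] cover[OF C xy(3)] by (simp only: of_nat_add)
  finally show False
    using big by (simp add: algebra_simps)
qed

text \<open>Carve off a slowly growing ball, put its even part into \<open>T\<close> and the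
  neighbours of that part into \<open>S\<close>, discard a thin shell, and recurse on the rest. The
  discarded vertices are charged to the carved ball.\<close>

lemma region_growing_round:
  assumes f: "\<And>x. x \<in> A \<Longrightarrow> f x \<subseteq> B" "finite B"
    and disj: "\<And>x y. x \<in> A \<Longrightarrow> y \<in> A \<Longrightarrow> y \<in> N x \<Longrightarrow> f x \<inter> f y = {}"
    and cover: "\<And>x y. x \<in> A \<Longrightarrow> y \<in> A \<Longrightarrow> y \<in> N x \<Longrightarrow> real (card (B - (f x \<union> f y))) \<le> E"
    and "E \<ge> 0" and big: "\<And>v. v \<in> A \<Longrightarrow> real (card (f v)) > real (2 * t + 1) * E"
    and "y > 0" "finite A" "(1 + y) ^ t > real (card A)" "C \<subseteq> A"
  shows "\<exists>S T. S \<subseteq> C \<and> T \<subseteq> C \<and> independent S \<and> nbhd C T \<subseteq> S \<and>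
           real (card (C - (S \<union> T))) \<le> y * real (card C)"
  using \<open>C \<subseteq> A\<close>
proof (induction "card C" arbitrary: C rule: less_induct)
  case less
  show ?case
  proof (cases "C = {}")
    case True
    then show ?thesis
      by (auto simp: nbhd_def independent_def)
  next
    case False
    then obtain v where v: "v \<in> C" by blast
    have finC: "finite C" by (rule finite_subset[OF less.prems \<open>finite A\<close>])
    have "real (card C) \<le> real (card A)"
      using less.prems \<open>finite A\<close> card_mono by auto
    then have "(1 + y) ^ t > real (card C)"
      using assms(9) by linarith
    then obtain i where i: "i < t"
      "real (card (ball_from C v (Suc i))) \<le> (1 + y) * real (card (ball_from C v i))"
      using exists_slow_growth[OF v finC \<open>y > 0\<close>] by blast
    define T0 where "T0 = even_ball C v i"
    define S0 where "S0 = nbhd C T0"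
    \<comment> \<open>The discarded layer: outside \<open>S0\<close> and \<open>T0\<close>, all
      neighbours of \<open>S0\<close> lie in \<open>X\<close>, so removing it separates
      \<open>S0\<close> from the remaining graph.\<close>
    define X where "X = nbhd C S0 - (S0 \<union> T0)"
    define C' where "C' = C - (S0 \<union> T0 \<union> X)"
    have T0C: "T0 \<subseteq> C" unfolding T0_def by (rule even_ball_subset[OF v])
    have subs: "S0 \<subseteq> C" "X \<subseteq> C" "C' \<subseteq> C"
      using nbhd_subset unfolding S0_def X_def C'_def by blast+
    have ball_eq: "ball_from C v i = S0 \<union> T0" "ball_from C v (Suc i) = T0 \<union> nbhd C S0 \<union> nbhd C (T0 \<union> nbhd C S0)"
      unfolding ball_from_def S0_def T0_def by auto
    have nbhd_mono: "nbhd D Y \<subseteq> nbhd D' Y'" if "D \<subseteq> D'" "Y \<subseteq> Y'" for D D' Y Y'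
      using that unfolding nbhd_def by blast
    have "nbhd C' X \<subseteq> nbhd C (T0 \<union> nbhd C S0)"
      using subs(3) by (intro nbhd_mono) (auto simp: X_def)
    moreover have "nbhd C' X \<inter> (S0 \<union> T0) = {}"
      unfolding C'_def nbhd_def by blast
    moreover have "S0 \<subseteq> nbhd C (T0 \<union> nbhd C S0)"
      unfolding S0_def by (intro nbhd_mono) auto
    ultimately have ball: "ball_from C v i = S0 \<union> T0"
      "X \<union> nbhd C' X \<subseteq> ball_from C v (Suc i) - (S0 \<union> T0)"
      "ball_from C v i \<subseteq> ball_from C v (Suc i)"
      unfolding ball_eq by (auto simp: X_def)
    have "v \<in> T0" unfolding T0_def by (induction i) auto
    then have smaller: "card C' < card C"
      using v finC unfolding C'_def by (intro psubset_card_mono) auto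
    have "C' \<subseteq> A" using less.prems subs(3) by (rule order.trans[rotated])
    from less.hyps[OF smaller this] obtain S' T' where IH: "S' \<subseteq> C'" "T' \<subseteq> C'" "independent S'" "nbhd C' T' \<subseteq> S'"
      "real (card (C' - (S' \<union> T'))) \<le> y * real (card C')"
      by blast
    \<comment> \<open>Vertices of \<open>T'\<close> next to the discarded layer have neighbours
      outside every \<open>S\<close>, so they must leave \<open>T'\<close>. Members of
      \<open>S'\<close> may stay.\<close>
    define Z where "Z = nbhd C' X"
    have fins: "finite S0" "finite T0" "finite X" "finite C'" "finite Z"
      using finite_subset[OF _ finC] subs T0C nbhd_subset[of C' X] unfolding Z_def
      by (meson order.trans)+
    have "independent S0"
    proof -
      have "real (2 * i + 1) * E \<le> real (2 * t + 1) * E"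
        using i \<open>E \<ge> 0\<close> by (intro mult_right_mono) auto
      then have "real (card (f v)) > real (2 * i + 1) * E"
        using big[of v] v less.prems by fastforce
      then have big': "real (card (f v)) > real (2 * i + 1) * E" .
      have CA: "\<And>x. x \<in> C \<Longrightarrow> x \<in> A" using less.prems by blast
      show ?thesis
        unfolding S0_def T0_def
        by (rule independent_nbhd_even_ball[where f = f and B = B and C = C and E = E, OF f(1)[OF CA] f(2) disj[OF CA CA] cover[OF CA CA]
              \<open>E \<ge> 0\<close> v big'])
    qed
    have no_edge: "y \<notin> N x \<and> x \<notin> N y" if "x \<in> S0" "y \<in> C'" for x y
      using that N_sym[of x y] N_sym[of y x] unfolding C'_def X_def nbhd_def by blast
    have "independent (S0 \<union> S')"
      using \<open>independent S0\<close> IH(1,3) no_edge unfolding independent_def by blast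
    moreover have "nbhd C (T0 \<union> (T' - Z)) \<subseteq> S0 \<union> S'"
    proof
      fix w assume "w \<in> nbhd C (T0 \<union> (T' - Z))"
      then obtain u where u: "u \<in> T0 \<union> (T' - Z)" "w \<in> N u" "w \<in> C" by (auto simp: nbhd_def)
      show "w \<in> S0 \<union> S'"
      proof (cases "u \<in> T0")
        case True
        then show ?thesis using u by (auto simp: S0_def nbhd_def)
      next
        case False
        then have uT: "u \<in> T'" "u \<notin> Z" "u \<in> C'" using u IH(2) by auto
        consider "w \<in> C'" | "w \<in> S0" | "w \<in> T0" | "w \<in> X"
          using u(3) unfolding C'_def by blast
        then show ?thesis
        proof cases
          case 1
          then show ?thesis using IH(4) uT u by (auto simp: nbhd_def)
        next
          case 3
          then have "u \<in> S0" using u uT subs N_sym[of w u] by (auto simp: S0_def nbhd_def)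
          then show ?thesis using uT by (simp add: C'_def)
        next
          case 4
          then have "u \<in> Z" using u uT N_sym[of w u] by (auto simp: Z_def nbhd_def)
          then show ?thesis using uT by simp
        qed simp
      qed
    qed
    \<comment> \<open>The new loss is contained in \<open>X \<union> Z\<close>, which lies in the
      shell between two consecutive balls and so has at most
      \<open>y * card (S0 \<union> T0)\<close> elements. As \<open>S0 \<union> T0\<close> and
      \<open>C'\<close> are disjoint, the losses sum to at most \<open>y * card C\<close>.\<close>
    moreover have "real (card (C - ((S0 \<union> S') \<union> (T0 \<union> (T' - Z))))) \<le> y * real (card C)"
    proof -
      have finB: "finite (ball_from C v j)" for j
        by (rule finite_subset[OF ball_from_subset[OF v] finC])
      have "C - ((S0 \<union> S') \<union> (T0 \<union> (T' - Z))) \<subseteq> (C' - (S' \<union> T')) \<union> (X \<union> Z)"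
        unfolding C'_def by blast
      then have "card (C - ((S0 \<union> S') \<union> (T0 \<union> (T' - Z)))) \<le> card ((C' - (S' \<union> T')) \<union> (X \<union> Z))"
        using fins by (intro card_mono) auto
      also have "\<dots> \<le> card (C' - (S' \<union> T')) + card (X \<union> Z)"
        by (rule card_Un_le)
      finally have 1: "real (card (C - ((S0 \<union> S') \<union> (T0 \<union> (T' - Z)))))
          \<le> real (card (C' - (S' \<union> T'))) + real (card (X \<union> Z))"
        by linarith
      have "card (X \<union> Z) \<le> card (ball_from C v (Suc i) - ball_from C v i)"
        using ball finB unfolding Z_def by (intro card_mono) auto
      also have "\<dots> = card (ball_from C v (Suc i)) - card (ball_from C v i)"
        using ball(3) finB by (intro card_Diff_subset) auto
      finally have "real (card (X \<union> Z)) \<le> y * real (card (S0 \<union> T0))"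
        using i(2) card_mono[OF finB ball(3)] unfolding ball(1) by (simp add: algebra_simps of_nat_diff)
      moreover have "card C' + card (S0 \<union> T0) \<le> card C"
      proof -
        have "card C' + card (S0 \<union> T0) = card (C' \<union> (S0 \<union> T0))"
          using fins by (intro card_Un_disjoint[symmetric]) (auto simp: C'_def)
        also have "\<dots> \<le> card C" using subs T0C finC by (intro card_mono) auto
        finally show ?thesis .
      qed
      then have "y * real (card C') + y * real (card (S0 \<union> T0)) \<le> y * real (card C)"
        using \<open>y > 0\<close> by (simp flip: distrib_left of_nat_add)
      ultimately show ?thesis using 1 IH(5) by linarith
    qed
    ultimately show ?thesis
      using subs T0C IH(1,2) by (intro exI[of _ "S0 \<union> S'"] exI[of _ "T0 \<union> (T' - Z)"]) blast
  qed
qed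

text \<open>Colour 0 is shared by the sets T of all rounds: the neighbours of such a set
  inside the remaining graph all lie in the corresponding S, which has its own colour.\<close>

lemma colourable_region_growing:
  assumes f: "\<And>x. x \<in> A \<Longrightarrow> f x \<subseteq> B" "finite B"
    and disj: "\<And>x y. x \<in> A \<Longrightarrow> y \<in> A \<Longrightarrow> y \<in> N x \<Longrightarrow> f x \<inter> f y = {}"
    and cover: "\<And>x y. x \<in> A \<Longrightarrow> y \<in> A \<Longrightarrow> y \<in> N x \<Longrightarrow> real (card (B - (f x \<union> f y))) \<le> E"
    and "E \<ge> 0" and big: "\<And>v. v \<in> A \<Longrightarrow> real (card (f v)) > real (2 * t + 1) * E"
    and "y > 0" "finite A" "(1 + y) ^ t > real (card A)"
    and "C \<subseteq> A" "y ^ k * real (card C) < 1"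
  shows "colourable C (k + 1)"
  using assms(10,11)
proof (induction k arbitrary: C)
  case 0
  moreover have "finite C" by (rule finite_subset[OF 0(1) \<open>finite A\<close>])
  ultimately have "C = {}" by simp
  then show ?case by (simp add: colourable_def)
next
  case (Suc k)
  obtain S T where ST: "S \<subseteq> C" "T \<subseteq> C" "independent S" "nbhd C T \<subseteq> S"
    "real (card (C - (S \<union> T))) \<le> y * real (card C)"
    using region_growing_round[where f = f and A = A and B = B and E = E and t = t, OF assms(1-9) Suc.prems(1)] by blast
  have "y ^ k * real (card (C - (S \<union> T))) \<le> y ^ k * (y * real (card C))"
    using ST(5) \<open>y > 0\<close> by (intro mult_left_mono) auto
  also have "\<dots> < 1"
    using Suc.prems(2) by (simp add: mult_ac)
  finally have "colourable (C - (S \<union> T)) (k + 1)"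
    using Suc.prems(1) by (intro Suc.IH) auto
  then obtain c where c: "\<And>v. v \<in> C - (S \<union> T) \<Longrightarrow> c v < k + 1"
    "\<And>u v. u \<in> C - (S \<union> T) \<Longrightarrow> v \<in> C - (S \<union> T) \<Longrightarrow> v \<in> N u \<Longrightarrow> c u \<noteq> c v"
    unfolding colourable_def by blast
  \<comment> \<open>The induction hypothesis uses colours \<open>0\<close> to \<open>k\<close>, so
    \<open>k + 1\<close> is new. \<open>S\<close> and \<open>T\<close> may overlap; a common vertex
    has no neighbour in \<open>C\<close>, and the test for \<open>S\<close> comes first.\<close>
  define e where "e v = (if v \<in> S then k + 1 else if v \<in> T then 0 else c v)" for v
  have "e v < Suc k + 1" if "v \<in> C" for v
    using c(1)[of v] that by (auto simp: e_def)
  moreover have "e u \<noteq> e v" if uv: "u \<in> C" "v \<in> C" "v \<in> N u" for u v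
  proof (cases "u \<in> T \<or> v \<in> T")
    case True
    then have "u \<in> S \<or> v \<in> S"
      using ST(4) uv N_sym[of v u] by (auto simp: nbhd_def)
    moreover have "\<not> (u \<in> S \<and> v \<in> S)"
      using ST(3) uv(3) by (auto simp: independent_def)
    ultimately show ?thesis
      using c(1)[of u] c(1)[of v] uv by (auto simp: e_def)
  next
    case False
    moreover have "\<not> (u \<in> S \<and> v \<in> S)"
      using ST(3) uv(3) by (auto simp: independent_def)
    ultimately show ?thesis
      using c(1)[of u] c(1)[of v] c(2)[of u v] uv by (auto simp: e_def)
  qed
  ultimately show ?case unfolding colourable_def by blast
qed

section \<open>Edges with sparse pairs of neighbourhoods\<close>

definition edges_between :: "'a set \<Rightarrow> 'a set \<Rightarrow> nat" where
  "edges_between P Q = (\<Sum>x\<in>P. card (N x \<inter> Q))"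

lemma edges_between_eq_card:
  assumes "finite P" "finite Q"
  shows "edges_between P Q = card {(x, y). x \<in> P \<and> y \<in> Q \<and> y \<in> N x}"
proof -
  have "{(x, y). x \<in> P \<and> y \<in> Q \<and> y \<in> N x} = (SIGMA x:P. N x \<inter> Q)"
    by auto
  then show ?thesis
    using assms by (simp add: edges_between_def card_SigmaI)
qed

lemma edges_between_commute:
  assumes "finite P" "finite Q"
  shows "edges_between P Q = edges_between Q P"
proof -
  have "bij_betw prod.swap {(x, y). x \<in> P \<and> y \<in> Q \<and> y \<in> N x} {(x, y). x \<in> Q \<and> y \<in> P \<and> y \<in> N x}"
    by (rule bij_betwI[where g = prod.swap]) (use N_sym in auto)
  then show ?thesis
    using assms by (simp add: edges_between_eq_card bij_betw_same_card)
qed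

definition inner_V :: "('a \<Rightarrow> real) \<Rightarrow> ('a \<Rightarrow> real) \<Rightarrow> real" where
  "inner_V g h = (\<Sum>x\<in>V. g x * h x)"

definition edge_vector :: "('a \<Rightarrow> 'a set) \<Rightarrow> 'a \<times> 'a \<Rightarrow> 'a \<Rightarrow> real" where
  "edge_vector F e x = indicator (F (fst e)) x - indicator (F (snd e)) x"

lemma sum_indicator_V:
  assumes "P \<subseteq> V"
  shows "(\<Sum>x\<in>V. indicator P x * g x) = (\<Sum>x\<in>P. g x :: real)"
proof -
  have "(\<Sum>x\<in>V. indicator P x * g x) = (\<Sum>x\<in>V \<inter> P. g x)"
    using finite_V by (simp add: indicator_def if_distrib sum.If_cases cong: if_cong)
  then show ?thesis
    using assms by (simp add: Int_absorb1)
qed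

text \<open>The two sets have equal size, so the vector sums to zero and the constant
  \<open>1 / 2\<close> contributes nothing; it only makes all matrix entries \<open>1 / 2\<close> or
  \<open>- 1 / 2\<close>. Each of \<open>F u\<close> and \<open>F v\<close> lies in a neighbourhood,
  hence is independent, and only the cross terms survive.\<close>

lemma edge_vector_quadratic_form:
  assumes "v \<in> N u" "F u \<subseteq> N u" "F v \<subseteq> N v" "card (F u) = card (F v)"
  shows "(\<Sum>x\<in>V. \<Sum>y\<in>V. edge_vector F (u, v) x * edge_vector F (u, v) y * (of_bool (y \<in> N x) - 1 / 2))
         = - 2 * real (edges_between (F u) (F v))"
proof -
  let ?D = "edge_vector F (u, v)"
  have sub: "F u \<subseteq> V" "F v \<subseteq> V" and fin: "finite (F u)" "finite (F v)"
    using assms N_subset finite_subset_V by (meson order.trans)+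
  have sumD: "(\<Sum>x\<in>V. ?D x * g x) = (\<Sum>x\<in>F u. g x) - (\<Sum>x\<in>F v. g x)" for g
    using sub by (simp add: edge_vector_def left_diff_distrib sum_subtractf sum_indicator_V)
  have cnt: "(\<Sum>y\<in>Y. of_bool (y \<in> N x)) = real (card (N x \<inter> Y))" if "finite Y" for x Y
    using that by (simp add: of_bool_def sum.If_cases Int_commute)
  have row: "(\<Sum>y\<in>V. ?D y * (of_bool (y \<in> N x) - 1 / 2))
      = real (card (N x \<inter> F u)) - real (card (N x \<inter> F v))" for x
    unfolding sumD sum_subtractf cnt[OF fin(1)] cnt[OF fin(2)] using assms(4) by simp
  have "(\<Sum>x\<in>V. \<Sum>y\<in>V. ?D x * ?D y * (of_bool (y \<in> N x) - 1 / 2))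
      = (\<Sum>x\<in>V. ?D x * (\<Sum>y\<in>V. ?D y * (of_bool (y \<in> N x) - 1 / 2)))"
    by (simp add: sum_distrib_left mult_ac)
  also have "\<dots> = (\<Sum>x\<in>F u. real (card (N x \<inter> F u)) - real (card (N x \<inter> F v)))
      - (\<Sum>x\<in>F v. real (card (N x \<inter> F u)) - real (card (N x \<inter> F v)))"
    unfolding row sumD ..
  also have "(\<Sum>x\<in>F u. real (card (N x \<inter> F u)) - real (card (N x \<inter> F v)))
      = - real (edges_between (F u) (F v))"
  proof -
    have "N x \<inter> F u = {}" if "x \<in> F u" for x
      using N_disjoint[of x u] assms(2) that by blast
    then show ?thesis
      by (simp add: edges_between_def sum_negf)
  qed
  also have "(\<Sum>x\<in>F v. real (card (N x \<inter> F u)) - real (card (N x \<inter> F v)))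
      = real (edges_between (F v) (F u))"
  proof -
    have "N x \<inter> F v = {}" if "x \<in> F v" for x
      using N_disjoint[of x v] assms(3) that by blast
    then show ?thesis
      by (simp add: edges_between_def)
  qed
  finally show ?thesis
    using edges_between_commute[OF fin] by simp
qed

text \<open>Colour \<open>u\<close> by the position, up to \<open>n / 60\<close>, of the inner products of the indicator
  of \<open>F u\<close> with the vectors found so far: a monochromatic edge extends the sequence.\<close>

lemma exists_almost_orthogonal_edges:
  assumes F: "\<And>v. v \<in> V \<Longrightarrow> F v \<subseteq> N v" "\<And>v. v \<in> V \<Longrightarrow> card (F v) = d"
    and "3 * d \<le> card V" and "V \<noteq> {}"
    and not_col: "\<not> colourable V (41 ^ M)" and "m \<le> M"
  shows "\<exists>es. length es = m \<and> (\<forall>e\<in>set es. snd e \<in> N (fst e)) \<and>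
    sorted_wrt (\<lambda>e e'. \<bar>inner_V (edge_vector F e) (edge_vector F e')\<bar> \<le> real (card V) / 60) es"
  using \<open>m \<le> M\<close>
proof (induction m)
  case 0
  then show ?case by simp
next
  case (Suc m)
  then obtain es where es: "length es = m" "\<forall>e\<in>set es. snd e \<in> N (fst e)"
    "sorted_wrt (\<lambda>e e'. \<bar>inner_V (edge_vector F e) (edge_vector F e')\<bar> \<le> real (card V) / 60) es"
    by auto
  define n where "n = real (card V)"
  have "n > 0"
    using assms(4) finite_V by (simp add: n_def card_gt_0_iff)
  \<comment> \<open>The inner product lies between \<open>- n / 3\<close> and \<open>n / 3\<close>.
    In units of \<open>n / 60\<close> the shifted value ranges over \<open>[0, 40]\<close>, so its
    floor takes 41 values: the base of the power \<open>41 ^ M\<close>.\<close>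
  define pos where "pos u e = (inner_V (indicator (F u)) (edge_vector F e) + n / 3) * 60 / n" for u e
  have pos_bounds: "0 \<le> pos u e \<and> pos u e \<le> 40" if "u \<in> V" for u e
  proof -
    have FV: "F u \<subseteq> V" using F(1)[OF that] N_subset by blast
    have "\<bar>inner_V (indicator (F u)) (edge_vector F e)\<bar> = \<bar>\<Sum>x\<in>F u. edge_vector F e x\<bar>"
      unfolding inner_V_def using FV by (simp add: sum_indicator_V)
    also have "\<dots> \<le> (\<Sum>x\<in>F u. \<bar>edge_vector F e x\<bar>)" by (rule sum_abs)
    also have "\<dots> \<le> (\<Sum>x\<in>F u. 1)"
      by (intro sum_mono) (auto simp: edge_vector_def indicator_def)
    also have "\<dots> = real d" using F(2)[OF that] by simp
    also have "\<dots> \<le> n / 3" using assms(3) unfolding n_def by linarith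
    finally have "\<bar>inner_V (indicator (F u)) (edge_vector F e)\<bar> \<le> n / 3" .
    then have "0 \<le> inner_V (indicator (F u)) (edge_vector F e) + n / 3"
      "inner_V (indicator (F u)) (edge_vector F e) + n / 3 \<le> 2 / 3 * n"
      by linarith+
    then show ?thesis
      using \<open>n > 0\<close> unfolding pos_def by (simp add: field_simps)
  qed
  define lab where "lab u = map (\<lambda>e. nat \<lfloor>pos u e\<rfloor>) es" for u
  define X where "X = {xs. set xs \<subseteq> {0..40::nat} \<and> length xs = m}"
  have X: "finite X" "card X = 41 ^ m"
    unfolding X_def by (simp_all add: finite_lists_length_eq card_lists_length_eq)
  have "lab u \<in> X" if "u \<in> V" for u
  proof -
    have "nat \<lfloor>pos u e\<rfloor> \<le> 40" for e
      using pos_bounds[OF that, of e] by linarith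
    then show ?thesis unfolding X_def lab_def using es(1) by auto
  qed
  moreover have "\<not> colourable V (card X)"
  proof
    assume "colourable V (card X)"
    moreover have "card X \<le> 41 ^ M" unfolding X(2) using Suc.prems by (intro power_increasing) auto
    ultimately show False using not_col colourable_mono by blast
  qed
  ultimately obtain u v where uv: "u \<in> V" "v \<in> V" "v \<in> N u" "lab u = lab v"
    using colourable_by_labels[OF X(1), of V lab] by blast
  have "\<bar>inner_V (edge_vector F (u, v)) (edge_vector F e)\<bar> \<le> n / 60" if "e \<in> set es" for e
  proof -
    have "nat \<lfloor>pos u e\<rfloor> = nat \<lfloor>pos v e\<rfloor>"
      using uv(4) that unfolding lab_def by simp
    then have "\<bar>pos u e - pos v e\<bar> \<le> 1"
      using pos_bounds[OF uv(1), of e] pos_bounds[OF uv(2), of e] by linarith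
    moreover have "pos u e - pos v e = inner_V (edge_vector F (u, v)) (edge_vector F e) * 60 / n"
    proof -
      have "inner_V (edge_vector F (u, v)) h = inner_V (indicator (F u)) h - inner_V (indicator (F v)) h"
        for h
        by (simp add: inner_V_def edge_vector_def left_diff_distrib sum_subtractf)
      from this[of "edge_vector F e"] show ?thesis
        unfolding pos_def by (simp add: diff_divide_distrib add_divide_distrib distrib_right left_diff_distrib)
    qed
    ultimately show ?thesis
      using \<open>n > 0\<close> by (simp add: abs_mult field_simps)
  qed
  then show ?case
    using es uv(3) unfolding n_def by (intro exI[of _ "(u, v) # es"]) auto
qed

text \<open>If every edge had a dense pair, all 238 almost orthogonal edge vectors would have
  quadratic form below \<open>- 232 / 10000 * n\<^sup>2\<close>, more than Cauchy--Schwarz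
  permits.\<close>

lemma exists_sparse_edge:
  assumes deg: "\<And>v. v \<in> V \<Longrightarrow> d \<le> card (N v)"
    and "3 * d \<le> card V" and "V \<noteq> {}"
    and not_col: "\<not> colourable V (41 ^ 238)"
  shows "\<exists>u v P Q. v \<in> N u \<and> P \<subseteq> N u \<and> Q \<subseteq> N v \<and> card P = d \<and> card Q = d \<and>
    real (edges_between P Q) \<le> 116 / 10000 * (real (card V))\<^sup>2"
proof (rule ccontr)
  assume neg: "\<not> ?thesis"
  define F where "F v = (SOME P. P \<subseteq> N v \<and> card P = d)" for v
  have F': "F v \<subseteq> N v \<and> card (F v) = d" if v: "v \<in> V" for v
  proof -
    obtain P where "P \<subseteq> N v" "card P = d"
      using obtain_subset_with_card_n[OF deg[OF v]] by metis
    then show ?thesis unfolding F_def by (metis (mono_tags, lifting) someI_ex)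
  qed
  then have F: "\<And>v. v \<in> V \<Longrightarrow> F v \<subseteq> N v" "\<And>v. v \<in> V \<Longrightarrow> card (F v) = d" by blast+
  define n where "n = real (card V)"
  have "n > 0"
    using assms(3) finite_V by (simp add: n_def card_gt_0_iff)
  obtain es where es: "length es = 238" "\<forall>e\<in>set es. snd e \<in> N (fst e)"
    "sorted_wrt (\<lambda>e e'. \<bar>inner_V (edge_vector F e) (edge_vector F e')\<bar> \<le> n / 60) es"
    using exists_almost_orthogonal_edges[OF F assms(2-4) order.refl] unfolding n_def by blast
  define D where "D i = edge_vector F (es ! i)" for i
  define W where "W x y = of_bool (y \<in> N x) - (1 / 2 :: real)" for x y
  have edge: "snd (es ! i) \<in> N (fst (es ! i))" "fst (es ! i) \<in> V" "snd (es ! i) \<in> V" if "i < 238" for i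
    using es(1,2) that mem_N_in_V by (metis nth_mem)+
  \<comment> \<open>After division by \<open>n ^ 4\<close> and by the number \<open>m\<close> of
    vectors, the bound reads \<open>m * ((232 / 10000)\<^sup>2 - 1 / 14400) \<le> 1 / 9\<close>; 238
    is the least \<open>m\<close> violating it.\<close>
  have "(real 238 * (232 / 10000 * n\<^sup>2))\<^sup>2 \<le> (real 238 * (4 / 9 * n\<^sup>2) + (real 238)\<^sup>2 * (n\<^sup>2 / 3600)) * ((real (card V))\<^sup>2 / 4)"
  proof (rule almost_orthogonal_bound[where D = D and W = W])
    fix i :: nat assume i: "i < 238"
    obtain u v where uv: "es ! i = (u, v)" by fastforce
    have e: "v \<in> N u" "u \<in> V" "v \<in> V" using edge[OF i] uv by auto
    have "(\<Sum>x\<in>V. \<Sum>y\<in>V. D i x * D i y * W x y) = - 2 * real (edges_between (F u) (F v))"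
      unfolding D_def W_def uv using F e by (intro edge_vector_quadratic_form) auto
    moreover have "real (edges_between (F u) (F v)) > 116 / 10000 * n\<^sup>2"
      using neg F' e unfolding n_def by (meson not_le)
    ultimately show "(\<Sum>x\<in>V. \<Sum>y\<in>V. D i x * D i y * W x y) \<le> - (232 / 10000 * n\<^sup>2)"
      by linarith
  next
    fix i j :: nat assume ij: "i < 238" "j < 238"
    have sq: "(inner_V (D i) (D j))\<^sup>2 \<le> n\<^sup>2 / 3600" if "i \<noteq> j"
    proof -
      have comm: "inner_V g h = inner_V h g" for g h
        unfolding inner_V_def by (simp add: mult.commute)
      have "\<bar>inner_V (D i) (D j)\<bar> \<le> n / 60"
        using that sorted_wrt_nth_less[OF es(3), of i j] sorted_wrt_nth_less[OF es(3), of j i] ij es(1) comm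
        unfolding D_def by (cases i j rule: linorder_cases) auto
      then have "\<bar>inner_V (D i) (D j)\<bar>\<^sup>2 \<le> (n / 60)\<^sup>2" by (intro power_mono) auto
      then show ?thesis by (simp add: power_divide)
    qed
    have diag: "(inner_V (D i) (D i))\<^sup>2 \<le> 4 / 9 * n\<^sup>2"
    proof -
      obtain u v where uv: "es ! i = (u, v)" by fastforce
      have e: "u \<in> V" "v \<in> V" using edge[OF ij(1)] uv by auto
      have FV: "F u \<subseteq> V" "F v \<subseteq> V" using F(1) e N_subset by blast+
      have "inner_V (D i) (D i) \<le> (\<Sum>x\<in>V. indicator (F u) x * 1 + indicator (F v) x * 1)"
        unfolding inner_V_def D_def uv by (intro sum_mono) (auto simp: edge_vector_def indicator_def)
      also have "\<dots> = real (2 * d)"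
        unfolding sum.distrib sum_indicator_V[OF FV(1)] sum_indicator_V[OF FV(2)]
        using F(2) e by simp
      also have "\<dots> \<le> 2 / 3 * n" using assms(2) unfolding n_def by linarith
      finally have "(inner_V (D i) (D i))\<^sup>2 \<le> (2 / 3 * n)\<^sup>2"
        by (intro power_mono) (auto simp: inner_V_def intro!: sum_nonneg)
      then show ?thesis by (simp add: power_mult_distrib power_divide)
    qed
    show "(\<Sum>x\<in>V. D i x * D j x)\<^sup>2 \<le> (if i = j then 4 / 9 * n\<^sup>2 else 0) + n\<^sup>2 / 3600"
    proof (cases "i = j")
      case True
      have "(inner_V (D i) (D i))\<^sup>2 \<le> 4 / 9 * n\<^sup>2 + n\<^sup>2 / 3600"
        using diag by (rule order.trans) simp
      then show ?thesis
        using True unfolding inner_V_def by simp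
    next
      case False
      then show ?thesis
        using sq unfolding inner_V_def by simp
    qed
  next
    fix x y show "(W x y)\<^sup>2 \<le> 1 / 4"
      unfolding W_def by (simp add: power2_eq_square)
  qed simp
  then have "(238 * (232 / 10000))\<^sup>2 * n ^ 4 \<le> (238 * (4 / 9) + 238\<^sup>2 / 3600) / 4 * n ^ 4"
    unfolding n_def by (simp add: power2_eq_square power4_eq_xxxx algebra_simps)
  then have "(238 * (232 / 10000))\<^sup>2 \<le> (238 * (4 / 9) + 238\<^sup>2 / 3600 :: real) / 4"
    using \<open>n > 0\<close> by (simp only: mult_le_cancel_right_pos zero_less_power)
  then show False by (simp add: power2_eq_square)
qed

section \<open>The structure around a sparse edge\<close>

lemma sum_card_Int_swap:
  assumes "finite P" "finite Q"
  shows "(\<Sum>x\<in>P. card (N x \<inter> Q)) = (\<Sum>y\<in>Q. card (N y \<inter> P))"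
  using edges_between_commute[OF assms] by (simp add: edges_between_def)

lemma sum_card_sparse_pair:
  assumes "P \<subseteq> N u" "Q \<subseteq> N v" "P \<inter> Q = {}"
  shows "(\<Sum>x\<in>P \<union> Q. card (N x \<inter> (P \<union> Q))) = 2 * edges_between P Q"
proof -
  have fin: "finite P" "finite Q"
    using assms(1,2) finite_N finite_subset by metis+
  have P: "N x \<inter> (P \<union> Q) = N x \<inter> Q" if "x \<in> P" for x
    using N_disjoint[of x u] assms(1) that by blast
  have Q: "N x \<inter> (P \<union> Q) = N x \<inter> P" if "x \<in> Q" for x
    using N_disjoint[of x v] assms(2) that by blast
  have "(\<Sum>x\<in>P \<union> Q. card (N x \<inter> (P \<union> Q)))
      = (\<Sum>x\<in>P. card (N x \<inter> (P \<union> Q))) + (\<Sum>x\<in>Q. card (N x \<inter> (P \<union> Q)))"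
    using fin assms(3) by (rule sum.union_disjoint)
  also have "\<dots> = edges_between P Q + edges_between Q P"
    unfolding edges_between_def using P Q by simp
  finally show ?thesis
    using edges_between_commute[OF fin] by simp
qed

text \<open>A vertex outside the majority set sends at least about \<open>n / 6\<close> edges to
  \<open>B\<close>. If it sent fewer than \<open>23 / 100 * n\<close>, its neighbours in
  \<open>B\<close> would have so few neighbours outside \<open>B\<close> that the edges inside
  \<open>B\<close> would exceed \<open>q\<close>.\<close>

lemma card_N_Int_lower:
  assumes deg: "\<And>v. v \<in> V \<Longrightarrow> d \<le> card (N v)"
    and B: "B \<subseteq> V" "card B = 2 * d"
    and inner: "real (\<Sum>x\<in>B. card (N x \<inter> B)) \<le> q"
    and z: "z \<in> V" "z \<notin> majority (V - B)"
    and n: "real (card V) = n" "3 * real d \<le> n" "n - 3 * real d \<le> n / 1000" "n > 0"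
    and q: "q = 232 / 10000 * n\<^sup>2"
  shows "23 / 100 * n \<le> real (card (N z \<inter> B))"
proof (rule ccontr)
  assume neg: "\<not> ?thesis"
  define Y X where "Y = N z \<inter> B" and "X = N z \<inter> (V - B)"
  define y x where "y = real (card Y)" and "x = real (card X)"
  have finB: "finite B" using B(1) by (rule finite_subset_V)
  have cardR: "real (card (V - B)) = n - 2 * real d"
    using B finB n card_mono[OF finite_V B(1)] by (simp add: card_Diff_subset of_nat_diff)
  have split: "real (card (N w)) = real (card (N w \<inter> B)) + real (card (N w \<inter> (V - B)))" for w
  proof -
    have "N w = (N w \<inter> B) \<union> (N w \<inter> (V - B))" using N_subset by blast
    then have "card (N w) = card ((N w \<inter> B) \<union> (N w \<inter> (V - B)))" by simp
    also have "\<dots> = card (N w \<inter> B) + card (N w \<inter> (V - B))"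
      by (intro card_Un_disjoint) auto
    finally show ?thesis by simp
  qed
  have dxy: "real d \<le> y + x"
    using deg[OF z(1)] split[of z] unfolding y_def x_def Y_def X_def by linarith
  have "2 * x \<le> n - 2 * real d"
    using z cardR unfolding majority_def x_def X_def by (auto simp: not_less)
  then have y_lower: "y \<ge> 2 * real d - n / 2" using dxy by linarith
  \<comment> \<open>\<open>w\<close> is adjacent to \<open>z\<close>, so it misses all of
    \<open>X\<close>, which has at least \<open>d - y\<close> elements.\<close>
  have out: "real (card (N w \<inter> (V - B))) \<le> n - 3 * real d + y" if "w \<in> Y" for w
  proof -
    have "N w \<inter> X = {}"
      using N_disjoint[of w z] that unfolding Y_def X_def by blast
    then have "card (N w \<inter> (V - B)) + card X = card ((N w \<inter> (V - B)) \<union> X)"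
      unfolding X_def by (intro card_Un_disjoint[symmetric]) auto
    also have "\<dots> \<le> card (V - B)"
      using finite_V unfolding X_def by (intro card_mono) auto
    finally show ?thesis
      using cardR dxy unfolding x_def by linarith
  qed
  have "y * real d \<le> (\<Sum>w\<in>Y. real (card (N w \<inter> B)) + (n - 3 * real d + y))"
  proof -
    have "y * real d = (\<Sum>w\<in>Y. real d)" by (simp add: y_def)
    also have "\<dots> \<le> (\<Sum>w\<in>Y. real (card (N w \<inter> B)) + (n - 3 * real d + y))"
    proof (intro sum_mono)
      fix w assume w: "w \<in> Y"
      then have "w \<in> V" using B(1) unfolding Y_def by blast
      then show "real d \<le> real (card (N w \<inter> B)) + (n - 3 * real d + y)"
        using deg[of w] split[of w] out[OF w] by linarith
    qed
    finally show ?thesis .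
  qed
  also have "\<dots> = real (\<Sum>w\<in>Y. card (N w \<inter> B)) + y * (n - 3 * real d + y)"
    by (simp add: sum.distrib y_def)
  also have "real (\<Sum>w\<in>Y. card (N w \<inter> B)) \<le> q"
  proof -
    have "(\<Sum>w\<in>Y. card (N w \<inter> B)) \<le> (\<Sum>w\<in>B. card (N w \<inter> B))"
      using finB unfolding Y_def by (intro sum_mono2) auto
    then show ?thesis using inner by linarith
  qed
  finally have main: "y * (4 * real d - n - y) \<le> 232 / 10000 * n\<^sup>2"
    unfolding q by (simp add: algebra_simps)
  have d: "real d \<ge> 333 / 1000 * n" using n by linarith
  have y: "y < 23 / 100 * n" "y \<ge> 166 / 1000 * n" using neg y_lower d unfolding y_def Y_def by linarith+
  have "y * (332 / 1000 * n - y) \<le> y * (4 * real d - n - y)"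
    using y d n(4) by (intro mult_left_mono) auto
  \<comment> \<open>The product \<open>y * (332 / 1000 * n - y)\<close> is concave with value
    \<open>2346 / 100000 * n\<^sup>2\<close> at both roots of this factorisation, just above the
    available \<open>232 / 10000 * n\<^sup>2\<close>.\<close>
  moreover have "(23 / 100 * n - y) * (y - 102 / 1000 * n) \<ge> 0"
    using y n(4) by (intro mult_nonneg_nonneg) auto
  moreover have "(23 / 100 * n - y) * (y - 102 / 1000 * n) = y * (332 / 1000 * n - y) - 2346 / 100000 * n\<^sup>2"
    by (simp add: field_simps power2_eq_square)
  moreover have "n\<^sup>2 > 0" using n(4) by simp
  ultimately show False using main by linarith
qed

section \<open>Generic edges and the vertices they hit\<close>

text \<open>The part of \<open>B\<close> lost to \<open>x\<close>: an end \<open>w\<close> adjacent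
  to \<open>x\<close> has no neighbour in common with \<open>x\<close>, so \<open>N x\<close> avoids
  this set.\<close>

definition covered :: "'a set \<Rightarrow> ('a \<times> 'a) list \<Rightarrow> 'a \<Rightarrow> 'a set" where
  "covered B es x = (\<Union>w\<in>(fst ` set es \<union> snd ` set es) \<inter> N x. N w) \<inter> B"

definition hits :: "('a \<times> 'a) list \<Rightarrow> 'a \<Rightarrow> nat" where
  "hits es x = length (filter (\<lambda>e. x \<in> N (fst e) \<union> N (snd e)) es)"

text \<open>Double counting: the ends of an edge have disjoint neighbourhoods, so every edge hits at
  least \<open>2 * d\<close> vertices.\<close>

lemma sum_hits:
  assumes deg: "\<And>v. v \<in> V \<Longrightarrow> d \<le> card (N v)" and "\<forall>e\<in>set es. snd e \<in> N (fst e)"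
  shows "2 * d * length es \<le> (\<Sum>x\<in>V. hits es x)"
  using assms(2)
proof (induction es)
  case Nil
  then show ?case by simp
next
  case (Cons e es)
  define M where "M = N (fst e) \<union> N (snd e)"
  have e: "snd e \<in> N (fst e)" using Cons.prems by simp
  have "card M = card (N (fst e)) + card (N (snd e))"
    unfolding M_def using N_disjoint[OF e] by (intro card_Un_disjoint) auto
  then have "2 * d \<le> card M"
    using deg[OF mem_N_in_V(1)[OF e]] deg[OF mem_N_in_V(2)[OF e]] by linarith
  moreover have "(\<Sum>x\<in>V. hits (e # es) x) = (\<Sum>x\<in>V. of_bool (x \<in> M) + hits es x)"
    by (intro sum.cong refl) (auto simp: hits_def M_def)
  moreover have "(\<Sum>x\<in>V. of_bool (x \<in> M)) = card M"
  proof -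
    have "V \<inter> M = M" using N_subset unfolding M_def by blast
    then show ?thesis using finite_V by (simp add: of_bool_def sum.If_cases)
  qed
  ultimately show ?case
    using Cons by (simp add: sum.distrib)
qed

text \<open>The edges are chosen so that no end of a new edge has the majority of any union of earlier
  neighbourhoods in \<open>B\<close>; hence the part of \<open>B\<close> lost to a vertex \<open>x\<close> grows with every edge that
  hits \<open>x\<close>.\<close>

lemma exists_generic_edges:
  assumes B: "B \<subseteq> V" and A: "A \<subseteq> V" "\<And>z. z \<in> A \<Longrightarrow> r \<le> real (card (N z \<inter> B))"
    and not_col: "\<not> colourable A (2 ^ (2 * M) + 1)" and "m \<le> M"
  shows "\<exists>es. length es = m \<and> (\<forall>e\<in>set es. fst e \<in> A \<and> snd e \<in> A \<and> snd e \<in> N (fst e)) \<and>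
    (\<forall>x. 2 * r * (1 - (1 / 2) ^ hits es x) \<le> real (card (covered B es x)))"
  using \<open>m \<le> M\<close>
proof (induction m)
  case 0
  then show ?case by (simp add: hits_def)
next
  case (Suc m)
  then obtain es where es: "length es = m"
    "\<forall>e\<in>set es. fst e \<in> A \<and> snd e \<in> A \<and> snd e \<in> N (fst e)"
    "\<And>x. 2 * r * (1 - (1 / 2) ^ hits es x) \<le> real (card (covered B es x))"
    by auto
  define Ends where "Ends = fst ` set es \<union> snd ` set es"
  define U where "U T = (\<Union>w\<in>T. N w) \<inter> B" for T
  have finB: "finite B" using B by (rule finite_subset_V)
  have finU: "finite (U T)" for T unfolding U_def using finB by simp
  have finE: "finite Ends" unfolding Ends_def by simp
  have "card Ends \<le> 2 * M"
  proof -
    have "card Ends \<le> card (fst ` set es) + card (snd ` set es)"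
      unfolding Ends_def by (rule card_Un_le)
    also have "\<dots> \<le> length es + length es"
      by (intro add_mono order.trans[OF card_image_le card_length]) auto
    finally show ?thesis using es(1) Suc.prems by simp
  qed
  then have cardI: "card (Pow Ends) \<le> 2 ^ (2 * M)"
    using finE by (simp add: card_Pow power_increasing)
  \<comment> \<open>A union of at most \<open>2 ^ (2 * M)\<close> independent sets, one for each set
    of earlier ends. One more colour would finish \<open>A\<close> if no edge were left outside
    \<open>H\<close>.\<close>
  define H where "H = (\<Union>T\<in>Pow Ends. majority (U T))"
  have "colourable H (card (Pow Ends))"
    unfolding H_def using finE finU by (intro colourable_Union_independent independent_majority) auto
  then have colH: "colourable H (2 ^ (2 * M))"
    using cardI colourable_mono by blast
  have "\<not> independent (A - H)"
  proof
    assume "independent (A - H)"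
    then have "colourable (H \<union> (A - H)) (2 ^ (2 * M) + 1)"
      using colH by (intro colourable_Un colourable_independent)
    then have "colourable A (2 ^ (2 * M) + 1)"
      by (rule colourable_subset) auto
    then show False using not_col by simp
  qed
  then obtain u v where uv: "u \<in> A - H" "v \<in> A - H" "v \<in> N u"
    unfolding independent_def by blast
  have half: "2 * real (card (N w \<inter> U T)) \<le> real (card (U T))" if "w \<in> {u, v}" "T \<subseteq> Ends" for w T
  proof -
    have "w \<notin> majority (U T)" "w \<in> V"
      using that uv A(1) unfolding H_def by auto
    then have "card (N w \<inter> U T) * 2 \<le> card (U T)"
      by (simp add: majority_def not_less)
    then show ?thesis by linarith
  qed
  have cov: "covered B es x = U (Ends \<inter> N x)" for x
    unfolding covered_def U_def Ends_def ..
  have "2 * r * (1 - (1 / 2) ^ hits ((u, v) # es) x) \<le> real (card (covered B ((u, v) # es) x))" for x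
  proof (cases "x \<in> N u \<union> N v")
    case False
    then have "hits ((u, v) # es) x = hits es x" by (simp add: hits_def)
    moreover have "card (covered B es x) \<le> card (covered B ((u, v) # es) x)"
      using finB by (intro card_mono) (auto simp: covered_def)
    ultimately show ?thesis
      using es(3)[of x] by simp
  next
    case True
    then obtain w where w: "w \<in> {u, v}" "x \<in> N w" by blast
    define T where "T = Ends \<inter> N x"
    have h: "hits ((u, v) # es) x = Suc (hits es x)"
      using True by (simp add: hits_def)
    have IH: "2 * r * (1 - (1 / 2) ^ hits es x) \<le> real (card (U T))"
      using es(3)[of x] unfolding cov T_def .
    have "U T \<union> (N w \<inter> B) \<subseteq> covered B ((u, v) # es) x"
      using w N_sym[OF w(2)] unfolding U_def T_def Ends_def covered_def by auto
    then have 1: "card (U T \<union> (N w \<inter> B)) \<le> card (covered B ((u, v) # es) x)"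
      using finB by (intro card_mono) (auto simp: covered_def)
    have "N w \<inter> U T = U T \<inter> (N w \<inter> B)" unfolding U_def by blast
    then have 2: "card (U T) + card (N w \<inter> B) = card (U T \<union> (N w \<inter> B)) + card (N w \<inter> U T)"
      using card_Un_Int[of "U T" "N w \<inter> B"] finU by simp
    have 3: "2 * real (card (N w \<inter> U T)) \<le> real (card (U T))"
      using half[OF w(1), of T] unfolding T_def by simp
    have 4: "r \<le> real (card (N w \<inter> B))"
      using A(2)[of w] w(1) uv by blast
    \<comment> \<open>The guaranteed size follows the recursion \<open>a \<mapsto> a / 2 + r\<close>
      from \<open>0\<close>: at least \<open>r\<close> vertices are added, and at most half of the
      old ones are counted twice.\<close>
    have "2 * r * (1 - (1 / 2) ^ Suc (hits es x)) = (2 * r * (1 - (1 / 2) ^ hits es x)) / 2 + r"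
      by (simp add: field_simps)
    also have "\<dots> \<le> real (card (U T)) / 2 + real (card (N w \<inter> B))"
      using IH 4 by linarith
    also have "\<dots> \<le> real (card (covered B ((u, v) # es) x))"
      using 1 2 3 by linarith
    finally show ?thesis unfolding h .
  qed
  then show ?case
    using es uv by (intro exI[of _ "(u, v) # es"]) auto
qed

text \<open>Five hits would cover at least \<open>2 * 0.23 * 31 / 32 * n\<close>, about
  \<open>0.4456 * n\<close>. Together with the disjoint \<open>0.23 * n\<close> neighbours of
  \<open>x\<close> this exceeds \<open>2 / 3 * n\<close>.\<close>

lemma hits_le_4:
  assumes "B \<subseteq> V" "3 * card B \<le> 2 * card V" "card V > 0"
    and "2 * (23 / 100 * real (card V)) * (1 - (1 / 2) ^ hits es x) \<le> real (card (covered B es x))"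
    and "23 / 100 * real (card V) \<le> real (card (N x \<inter> B))"
  shows "hits es x \<le> 4"
proof (rule ccontr)
  assume "\<not> ?thesis"
  then have "(1 / 2 :: real) ^ hits es x \<le> (1 / 2) ^ 5"
    by (intro power_decreasing) auto
  then have "2 * (23 / 100 * real (card V)) * (31 / 32) \<le> 2 * (23 / 100 * real (card V)) * (1 - (1 / 2) ^ hits es x)"
    by (intro mult_left_mono) (auto simp: power_divide)
  moreover have "card (covered B es x) + card (N x \<inter> B) \<le> card B"
  proof -
    have finB: "finite B" using assms(1) by (rule finite_subset_V)
    have "covered B es x \<inter> (N x \<inter> B) = {}"
      using N_disjoint[of _ x] unfolding covered_def by blast
    then have "card (covered B es x) + card (N x \<inter> B) = card (covered B es x \<union> (N x \<inter> B))"
      using finB by (intro card_Un_disjoint[symmetric]) (auto simp: covered_def)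
    also have "\<dots> \<le> card B"
      using finB by (intro card_mono) (auto simp: covered_def)
    finally show ?thesis .
  qed
  ultimately show False
    using assms(2-5) by linarith
qed

text \<open>Two double counts, of the edges leaving \<open>B\<close> and of the hits of 80 generic
  edges in \<open>A\<close>, together bound \<open>A\<close> and the exceptional part
  \<open>C0\<close> of \<open>C\<close> by multiples of \<open>n - 3 * d\<close>.\<close>

lemma structure_of_uncolourable:
  assumes deg: "\<And>v. v \<in> V \<Longrightarrow> d \<le> card (N v)"
    and n: "real (card V) = n" "3 * real d \<le> n" "n - 3 * real d \<le> n / 1000" "n > 0"
    and not_col: "\<not> colourable V (41 ^ 238)"
  shows "\<exists>B C A. V = B \<union> C \<union> A \<and> B \<subseteq> V \<and> A \<subseteq> V \<and> independent B \<and> independent C \<and>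
    (colourable A (2 ^ 160 + 1) \<or>
      real (card A) \<le> 20 * (n - 3 * real d) \<and>
      (\<forall>x\<in>A. \<forall>y\<in>A. y \<in> N x \<longrightarrow> real (card (B - (N x \<union> N y))) \<le> 21 * (n - 3 * real d)) \<and>
      (\<forall>x\<in>A. 129 / 1000 * n \<le> real (card (N x \<inter> B))))"
proof -
  define s where "s = n - 3 * real d"
  have "V \<noteq> {}" using n by auto
  have "3 * d \<le> card V" using n by linarith
  obtain u v P Q where uv: "v \<in> N u" "P \<subseteq> N u" "Q \<subseteq> N v" "card P = d" "card Q = d"
    "real (edges_between P Q) \<le> 116 / 10000 * (real (card V))\<^sup>2"
    using exists_sparse_edge[OF deg \<open>3 * d \<le> card V\<close> \<open>V \<noteq> {}\<close> not_col] by blast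
  have disjPQ: "P \<inter> Q = {}" using N_disjoint[OF uv(1)] uv(2,3) by blast
  define B0 where "B0 = P \<union> Q"
  have B0: "B0 \<subseteq> V" using uv(2,3) N_subset unfolding B0_def by blast
  have finPQ: "finite P" "finite Q"
    using uv(2,3) finite_N finite_subset by metis+
  have cardB0: "card B0 = 2 * d"
    unfolding B0_def using card_Un_disjoint[OF finPQ disjPQ] uv(4,5) by simp
  have inner: "real (\<Sum>x\<in>B0. card (N x \<inter> B0)) \<le> 232 / 10000 * n\<^sup>2"
    using uv(6) sum_card_sparse_pair[OF uv(2,3) disjPQ] n(1) unfolding B0_def by simp
  \<comment> \<open>The sparse set \<open>B0\<close> of size \<open>2 * d\<close> is replaced by a
    truly independent set that contains most of it.\<close>
  define B where "B = majority (V - B0)"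
  define b where "b = real (card B)"
  have BV: "B \<subseteq> V" unfolding B_def majority_def by blast
  have finB: "finite B" using BV by (rule finite_subset_V)
  have indB: "independent B" unfolding B_def using finite_V by (intro independent_majority) auto
  have toB0: "23 / 100 * n \<le> real (card (N z \<inter> B0))" if "z \<in> V" "z \<notin> B" for z
    using card_N_Int_lower[OF deg B0 cardB0 inner that(1) _ n refl] that(2) unfolding B_def by blast
  \<comment> \<open>Each vertex of \<open>B0 - B\<close> accounts for \<open>0.23 * n\<close> of the
    at most \<open>0.0232 * n\<^sup>2\<close> adjacent ordered pairs in \<open>B0\<close>.\<close>
  have B0B: "real (card (B0 - B)) \<le> 101 / 1000 * n"
  proof -
    have "real (card (B0 - B)) * (23 / 100 * n) = (\<Sum>z\<in>B0 - B. 23 / 100 * n)" by simp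
    also have "\<dots> \<le> (\<Sum>z\<in>B0 - B. real (card (N z \<inter> B0)))"
      using B0 by (intro sum_mono toB0) auto
    also have "\<dots> \<le> (\<Sum>z\<in>B0. real (card (N z \<inter> B0)))"
      using finPQ unfolding B0_def by (intro sum_mono2) auto
    also have "\<dots> \<le> 232 / 10000 * n\<^sup>2" using inner by simp
    finally have "real (card (B0 - B)) * (23 / 100) \<le> 232 / 10000 * n"
      using n(4) by (simp add: power2_eq_square)
    then show ?thesis using n(4) by linarith
  qed
  have d: "real d \<ge> 333 / 1000 * n" using n by linarith
  have b_lower: "b \<ge> 5 / 10 * n"
  proof -
    have "card B0 \<le> card (B0 - B) + card B"
    proof -
      have "card B0 \<le> card ((B0 - B) \<union> B)"
        using finB finPQ unfolding B0_def by (intro card_mono) auto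
      also have "\<dots> \<le> card (B0 - B) + card B" by (rule card_Un_le)
      finally show ?thesis .
    qed
    then show ?thesis using B0B cardB0 d unfolding b_def by linarith
  qed
  have b_upper: "b \<le> n - real d"
  proof -
    obtain x where x: "x \<in> B" using b_lower n(4) unfolding b_def by fastforce
    have "card (N x) + card B = card (N x \<union> B)"
      using indB x finB by (intro card_Un_disjoint[symmetric]) (auto simp: independent_def)
    also have "\<dots> \<le> card V" using finite_V N_subset BV by (intro card_mono) auto
    finally show ?thesis using deg[of x] x BV n(1) unfolding b_def by fastforce
  qed
  have toB: "129 / 1000 * n \<le> real (card (N z \<inter> B))" if "z \<in> V" "z \<notin> B" for z
  proof -
    have "card (N z \<inter> B0) \<le> card ((N z \<inter> B) \<union> (B0 - B))"
      using finPQ unfolding B0_def by (intro card_mono) auto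
    also have "\<dots> \<le> card (N z \<inter> B) + card (B0 - B)" by (rule card_Un_le)
    finally show ?thesis using toB0[OF that] B0B by linarith
  qed
  define C where "C = majority B - B"
  define A where "A = V - B - C"
  \<comment> \<open>The vertices of \<open>C\<close> that may still have neighbours in
    \<open>A\<close>; the others see too much of \<open>B\<close>.\<close>
  define C0 where "C0 = {x \<in> C. real (card (N x \<inter> B)) \<le> 9 / 10 * b}"
  have indC: "independent C"
    using independent_majority[OF finB] independent_subset unfolding C_def by blast
  have CV: "C \<subseteq> V" unfolding C_def majority_def by blast
  have V: "V = B \<union> C \<union> A" using BV CV unfolding A_def by blast
  have AV: "A \<subseteq> V" unfolding A_def by blast
  have C0C: "C0 \<subseteq> C" unfolding C0_def by blast
  have finCA: "finite C" "finite A" "finite C0"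
    using CV AV C0C finite_subset_V by blast+
  define a c c0 where "a = real (card A)" and "c = real (card C)" and "c0 = real (card C0)"
  have sum_V: "(\<Sum>x\<in>V. g x) = (\<Sum>x\<in>B. g x) + (\<Sum>x\<in>A. g x) + (\<Sum>x\<in>C0. g x) + (\<Sum>x\<in>C - C0. g x)"
    for g :: "'a \<Rightarrow> real"
  proof -
    have "V = (B \<union> A) \<union> C" using V by blast
    moreover have "sum g ((B \<union> A) \<union> C) = sum g (B \<union> A) + sum g C"
      using finB finCA by (intro sum.union_disjoint) (auto simp: A_def C_def)
    ultimately have "(\<Sum>x\<in>V. g x) = (\<Sum>x\<in>B \<union> A. g x) + (\<Sum>x\<in>C. g x)" by simp
    also have "(\<Sum>x\<in>B \<union> A. g x) = (\<Sum>x\<in>B. g x) + (\<Sum>x\<in>A. g x)"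
      using finB finCA by (intro sum.union_disjoint) (auto simp: A_def)
    also have "(\<Sum>x\<in>C. g x) = (\<Sum>x\<in>C - C0. g x) + (\<Sum>x\<in>C0. g x)"
      using finCA C0C by (intro sum.subset_diff)
    finally show ?thesis by simp
  qed
  have card_CC0: "real (card (C - C0)) = c - c0"
    using finCA C0C card_mono[OF finCA(1) C0C] unfolding c_def c0_def
    by (simp add: card_Diff_subset of_nat_diff)
  have n_eq: "n = b + a + c"
    using sum_V[of "\<lambda>_. 1"] card_CC0 n(1) unfolding a_def b_def c0_def by simp
  have degrees: "real d \<le> 5 / 10 * a + c - 1 / 10 * c0"
  proof -
    have "b * real d = (\<Sum>x\<in>B. real d)" unfolding b_def by simp
    also have "\<dots> \<le> (\<Sum>x\<in>B. real (card (N x \<inter> V)))"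
    proof (intro sum_mono of_nat_mono)
      fix x assume "x \<in> B"
      moreover have "N x \<inter> V = N x" using N_subset by blast
      ultimately show "d \<le> card (N x \<inter> V)" using deg[of x] BV by auto
    qed
    also have "\<dots> = (\<Sum>x\<in>V. real (card (N x \<inter> B)))"
      using sum_card_Int_swap[OF finB finite_V] by (metis of_nat_sum)
    also have "\<dots> = (\<Sum>x\<in>B. real (card (N x \<inter> B))) + (\<Sum>x\<in>A. real (card (N x \<inter> B)))
        + (\<Sum>x\<in>C0. real (card (N x \<inter> B))) + (\<Sum>x\<in>C - C0. real (card (N x \<inter> B)))"
      by (rule sum_V)
    also have "\<dots> \<le> (\<Sum>x\<in>B. 0) + (\<Sum>x\<in>A. 5 / 10 * b) + (\<Sum>x\<in>C0. 9 / 10 * b) + (\<Sum>x\<in>C - C0. b)"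
    proof (intro add_mono sum_mono)
      fix x assume "x \<in> B"
      then have "N x \<inter> B = {}" using indB unfolding independent_def by blast
      then show "real (card (N x \<inter> B)) \<le> 0" by simp
    next
      fix x assume "x \<in> A"
      then have "x \<in> V" "x \<notin> majority B" unfolding A_def C_def by blast+
      then have "card (N x \<inter> B) * 2 \<le> card B" by (simp add: majority_def not_less)
      then show "real (card (N x \<inter> B)) \<le> 5 / 10 * b" unfolding b_def by linarith
    next
      fix x assume "x \<in> C0"
      then show "real (card (N x \<inter> B)) \<le> 9 / 10 * b" unfolding C0_def by blast
    next
      fix x show "real (card (N x \<inter> B)) \<le> b"
        unfolding b_def using finB by (intro of_nat_mono card_mono) auto
    qed
    also have "\<dots> = a * (5 / 10 * b) + c0 * (9 / 10 * b) + (c - c0) * b"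
      unfolding a_def c0_def using card_CC0 by (simp add: c0_def)
    also have "\<dots> = b * (5 / 10 * a + c - 1 / 10 * c0)"
      by (simp add: algebra_simps)
    finally show ?thesis
      using b_lower n(4) by simp
  qed
  show ?thesis
  proof (cases "colourable A (2 ^ 160 + 1)")
    case True
    then show ?thesis using V BV AV indB indC by blast
  next
    case False
    then have not_col_A: "\<not> colourable A (2 ^ (2 * 80) + 1)" by simp
    have toB0_A: "23 / 100 * n \<le> real (card (N z \<inter> B0))" if "z \<in> A" for z
      using toB0 that unfolding A_def by blast
    \<comment> \<open>Genericity is taken relative to \<open>B0\<close>, where the bound
      \<open>0.23 * n\<close> holds. With 80 edges, a vertex hit at most 4 times costs
      \<open>4 / 80 = 1 / 20\<close>, which is less than the saving of \<open>1 / 10\<close> for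
      \<open>C0\<close> and \<open>1 / 2\<close> for \<open>A\<close> in
      \<open>degrees\<close>.\<close>
    obtain es where es: "length es = 80"
      "\<forall>e\<in>set es. fst e \<in> A \<and> snd e \<in> A \<and> snd e \<in> N (fst e)"
      "\<And>x. 2 * (23 / 100 * n) * (1 - (1 / 2) ^ hits es x) \<le> real (card (covered B0 es x))"
      using exists_generic_edges[OF B0 AV toB0_A not_col_A order.refl] by blast
    \<comment> \<open>Adjacent vertices split \<open>B\<close>, but more than
      \<open>9 / 10 * b\<close> and at least \<open>0.129 * n\<close> do not fit together since
      \<open>b \<le> n - d\<close>.\<close>
    have no_edge: "x \<notin> N w" if x: "x \<in> C - C0" and w: "w \<in> A" for x w
    proof
      assume xw: "x \<in> N w"
      have "card (N x \<inter> B) + card (N w \<inter> B) = card ((N x \<inter> B) \<union> (N w \<inter> B))"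
        using N_disjoint[OF xw] by (intro card_Un_disjoint[symmetric]) auto
      also have "\<dots> \<le> card B" using finB by (intro card_mono) auto
      finally have "real (card (N x \<inter> B)) + real (card (N w \<inter> B)) \<le> b"
        unfolding b_def by linarith
      moreover have "real (card (N x \<inter> B)) > 9 / 10 * b" using x unfolding C0_def by fastforce
      moreover have "129 / 1000 * n \<le> real (card (N w \<inter> B))" using toB w unfolding A_def by blast
      ultimately show False using b_upper d n(4) by linarith
    qed
    have few: "real (hits es x) \<le> 4" if "x \<in> V" "x \<notin> B" for x
      using hits_le_4[of B0 es x] B0 cardB0 \<open>3 * d \<le> card V\<close> n es(3)[of x] toB0[OF that] by simp
    have "160 * real d \<le> 80 * b + 4 * a + 4 * c0"
    proof -
      have "2 * d * 80 \<le> (\<Sum>x\<in>V. hits es x)"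
        using sum_hits[OF deg, of es] es(1,2) by simp
      then have "160 * real d \<le> (\<Sum>x\<in>V. real (hits es x))"
        unfolding of_nat_sum[symmetric] by linarith
      also have "\<dots> = (\<Sum>x\<in>B. real (hits es x)) + (\<Sum>x\<in>A. real (hits es x))
          + (\<Sum>x\<in>C0. real (hits es x)) + (\<Sum>x\<in>C - C0. real (hits es x))"
        by (rule sum_V)
      also have "\<dots> \<le> (\<Sum>x\<in>B. 80) + (\<Sum>x\<in>A. 4) + (\<Sum>x\<in>C0. 4) + (\<Sum>x\<in>C - C0. 0)"
      proof (intro add_mono sum_mono)
        fix x show "real (hits es x) \<le> 80"
          using length_filter_le[of _ es] es(1) unfolding hits_def by (metis of_nat_le_iff of_nat_numeral)
      next
        fix x assume "x \<in> A" then show "real (hits es x) \<le> 4"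
          using few[of x] unfolding A_def by blast
      next
        fix x assume "x \<in> C0" then show "real (hits es x) \<le> 4"
          using few[of x] C0C CV unfolding C_def by blast
      next
        fix x assume "x \<in> C - C0"
        then have "filter (\<lambda>e. x \<in> N (fst e) \<union> N (snd e)) es = []"
          using no_edge es(2) by (auto simp: filter_empty_conv)
        then show "real (hits es x) \<le> 0" unfolding hits_def by simp
      qed
      finally show ?thesis unfolding a_def b_def c0_def by simp
    qed
    \<comment> \<open>Divided by 80, the hit count gives
      \<open>b \<ge> 2 * d - (a + c0) / 20\<close>. Add \<open>degrees\<close> and substitute into
      \<open>n = b + a + c\<close>.\<close>
    then have main: "45 / 100 * a + 5 / 100 * c0 \<le> s"
      using degrees n_eq unfolding s_def by linarith
    have nonneg: "a \<ge> 0" "c0 \<ge> 0" unfolding a_def c0_def by simp_all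
    have cardA: "real (card A) \<le> 20 * s"
      using main nonneg unfolding a_def[symmetric] by linarith
    have cover: "real (card (B - (N x \<union> N y))) \<le> 21 * s" if xy: "x \<in> A" "y \<in> A" "y \<in> N x" for x y
    proof -
      let ?M = "N x \<union> N y"
      have xV: "x \<in> V" "y \<in> V" using xy AV by blast+
      have "card ?M = card (N x) + card (N y)"
        using N_disjoint[OF xy(3)] by (intro card_Un_disjoint) auto
      then have 1: "2 * real d \<le> real (card ?M)"
        using deg[OF xV(1)] deg[OF xV(2)] by linarith
      \<comment> \<open>The at least \<open>2 * d\<close> vertices of \<open>?M\<close> lie in
        \<open>B\<close> up to \<open>a + c0\<close> exceptions, and \<open>b - 2 * d\<close> is at
        most \<open>s\<close>.\<close>
      have "?M \<subseteq> (?M \<inter> B) \<union> (A \<union> C0)"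
        using N_subset[of x] N_subset[of y] V no_edge[OF _ xy(1)] no_edge[OF _ xy(2)] by blast
      then have "card ?M \<le> card ((?M \<inter> B) \<union> (A \<union> C0))"
        using finCA by (intro card_mono) auto
      also have "\<dots> \<le> card (?M \<inter> B) + (card A + card C0)"
        by (intro order.trans[OF card_Un_le] add_mono order.refl card_Un_le)
      finally have 2: "real (card ?M) \<le> real (card (?M \<inter> B)) + a + c0"
        unfolding a_def c0_def by linarith
      have "card (B - ?M) + card (?M \<inter> B) = card B"
        using finB by (metis Int_commute add.commute card_Int_Diff)
      then have 3: "real (card (B - ?M)) + real (card (?M \<inter> B)) = b"
        unfolding b_def by linarith
      have "a + c0 \<le> 20 * s" using main nonneg by linarith
      moreover have "real (card (B - ?M)) \<le> s + (a + c0)"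
        using 1 2 3 b_upper unfolding s_def by linarith
      ultimately show ?thesis by linarith
    qed
    have toB_A: "129 / 1000 * n \<le> real (card (N x \<inter> B))" if "x \<in> A" for x
      using toB that unfolding A_def by blast
    show ?thesis
      unfolding s_def[symmetric]
      by (intro exI[of _ B] exI[of _ C] exI[of _ A] conjI disjI2 ballI impI V BV AV indB indC
          cardA cover toB_A; assumption)
  qed
qed

section \<open>Combining the structure with region growing\<close>

lemma colourable_of_min_degree:
  assumes deg: "\<And>v. v \<in> V \<Longrightarrow> d \<le> card (N v)"
    and n: "real (card V) = n" "3 * real d \<le> n" "n - 3 * real d \<le> n / 1000" "n > 0"
    and y: "y > 0" "20 * (n - 3 * real d) < (1 + y) ^ t" "y ^ k * (20 * (n - 3 * real d)) < 1"
    and t: "real (2 * t + 1) * (21 * (n - 3 * real d)) < 129 / 1000 * n"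
  shows "colourable V (10 ^ 391 + 1 + k)"
proof (cases "colourable V (41 ^ 238)")
  case True
  then show ?thesis by (rule colourable_mono) simp
next
  case False
  then obtain B C A where st: "V = B \<union> C \<union> A" "B \<subseteq> V" "A \<subseteq> V" "independent B" "independent C"
    and cases: "colourable A (2 ^ 160 + 1) \<or>
      real (card A) \<le> 20 * (n - 3 * real d) \<and>
      (\<forall>x\<in>A. \<forall>y\<in>A. y \<in> N x \<longrightarrow> real (card (B - (N x \<union> N y))) \<le> 21 * (n - 3 * real d)) \<and>
      (\<forall>x\<in>A. 129 / 1000 * n \<le> real (card (N x \<inter> B)))"
    using structure_of_uncolourable[OF deg n] by metis
  \<comment> \<open>\<open>B\<close> and \<open>C\<close> take one colour each. The constant
    \<open>10 ^ 391\<close> exceeds both \<open>41 ^ 238\<close> (about \<open>10 ^ 384\<close>) and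
    \<open>2 ^ 160 + 3\<close>.\<close>
  have extend: "colourable V (10 ^ 391 + 1 + k)" if "colourable A l" "1 + 1 + l \<le> 10 ^ 391 + 1 + k" for l
    using st(1,4,5) that colourable_Un[OF colourable_Un, of B 1 C 1 A l]
    by (metis colourable_independent colourable_mono)
  from cases show ?thesis
  proof
    assume "colourable A (2 ^ 160 + 1)"
    then show ?thesis by (rule extend) simp
  next
    assume A: "real (card A) \<le> 20 * (n - 3 * real d) \<and>
      (\<forall>x\<in>A. \<forall>y\<in>A. y \<in> N x \<longrightarrow> real (card (B - (N x \<union> N y))) \<le> 21 * (n - 3 * real d)) \<and>
      (\<forall>x\<in>A. 129 / 1000 * n \<le> real (card (N x \<inter> B)))"
    have "y ^ k * real (card A) \<le> y ^ k * (20 * (n - 3 * real d))"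
      using A y(1) by (intro mult_left_mono) auto
    then have small: "y ^ k * real (card A) < 1" using y(3) by linarith
    have "colourable A (k + 1)"
    \<comment> \<open>Neighbourhoods in \<open>B\<close> of adjacent vertices of \<open>A\<close>
      are disjoint and miss at most \<open>21 * (n - 3 * d)\<close> elements of \<open>B\<close>, as
      region growing requires.\<close>
    proof (rule colourable_region_growing[where f = "\<lambda>x. N x \<inter> B" and B = B and A = A
          and E = "21 * (n - 3 * real d)" and t = t and y = y])
      show "finite B" "finite A" using st(2,3) finite_subset_V by blast+
      show "N x \<inter> B \<subseteq> B" for x by blast
      show "N x \<inter> B \<inter> (N z \<inter> B) = {}" if "z \<in> N x" for x z
        using N_disjoint[OF that] by blast
      show "real (card (B - (N x \<inter> B \<union> N z \<inter> B))) \<le> 21 * (n - 3 * real d)"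
        if "x \<in> A" "z \<in> A" "z \<in> N x" for x z
      proof -
        have "B - (N x \<inter> B \<union> N z \<inter> B) = B - (N x \<union> N z)" by blast
        then show ?thesis using A that by metis
      qed
      show "0 \<le> 21 * (n - 3 * real d)" using n(2) by simp
      show "real (2 * t + 1) * (21 * (n - 3 * real d)) < real (card (N v \<inter> B))" if "v \<in> A" for v
        using A that t by (blast intro: less_le_trans)
      show "real (card A) < (1 + y) ^ t" using A y(2) by linarith
    qed (use y(1) small in auto)
    then show ?thesis
    proof (rule extend)
      have "(2::nat) \<le> 10 ^ 391" by simp
      then show "1 + 1 + (k + 1) \<le> 10 ^ 391 + 1 + k" by linarith
    qed
  qed
qed

end

section \<open>The asymptotic estimate\<close>

text \<open>The final argument has \<open>n - 3 * d \<le> 3 * n powr (1 - \<delta>)\<close>, whence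
  \<open>60 = 3 * 20\<close> and \<open>63 = 3 * 21\<close>. Take
  \<open>y = n powr (- \<beta>)\<close> with \<open>\<beta>\<close> slightly below
  \<open>\<delta>\<close> and \<open>t\<close> of order \<open>n powr \<delta>\<close>: then
  \<open>t * y\<close> is a positive power of \<open>n\<close>, so \<open>(1 + y) ^ t\<close>
  outgrows every polynomial.\<close>

lemma eventually_parameters:
  fixes \<delta> \<epsilon> :: real
  assumes "0 < \<delta>" "\<delta> < 1" "0 < \<epsilon>"
  defines "k \<equiv> nat \<lceil>(1 + \<epsilon>) * (1 - \<delta>) / \<delta>\<rceil>"
  shows "\<forall>\<^sub>F n in at_top. 1 \<le> n powr (1 - \<delta>) \<and> 3 * n powr (1 - \<delta>) \<le> n / 1000 \<and>
    (\<exists>t y. y > 0 \<and> 60 * n powr (1 - \<delta>) < (1 + y) ^ t \<and> y ^ k * (60 * n powr (1 - \<delta>)) < 1 \<and>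
       real (2 * t + 1) * (63 * n powr (1 - \<delta>)) < 129 / 1000 * n)"
proof -
  \<comment> \<open>Half of \<open>\<epsilon>\<close> is spent on \<open>\<beta> < \<delta>\<close>;
    the rest keeps \<open>\<beta> * k\<close> above \<open>1 - \<delta>\<close>, so that
    \<open>y ^ k\<close> beats \<open>n powr (1 - \<delta>)\<close>.\<close>
  define \<beta> where "\<beta> = \<delta> / (1 + \<epsilon> / 2)"
  define \<gamma> where "\<gamma> = \<delta> - \<beta>"
  have \<beta>: "\<beta> > 0" using assms by (simp add: \<beta>_def)
  have "\<beta> < \<delta>" using assms by (simp add: \<beta>_def field_simps)
  then have \<gamma>: "\<gamma> > 0" by (simp add: \<gamma>_def)
  have "1 - \<delta> < \<beta> * real k"
  proof -
    have "(1 + \<epsilon>) * (1 - \<delta>) / \<delta> \<le> real k" unfolding k_def by linarith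
    then have "\<beta> * ((1 + \<epsilon>) * (1 - \<delta>) / \<delta>) \<le> \<beta> * real k"
      using \<beta> by (intro mult_left_mono) auto
    moreover have "1 - \<delta> < \<beta> * ((1 + \<epsilon>) * (1 - \<delta>) / \<delta>)"
    proof -
      have "(1 - \<delta>) * 1 < (1 - \<delta>) * ((1 + \<epsilon>) / (1 + \<epsilon> / 2))"
        using assms by (intro mult_strict_left_mono) (simp_all add: field_simps)
      also have "\<dots> = \<beta> * ((1 + \<epsilon>) * (1 - \<delta>) / \<delta>)"
        using assms unfolding \<beta>_def by simp
      finally show ?thesis by simp
    qed
    ultimately show ?thesis by linarith
  qed
  then obtain \<eta> where \<eta>: "\<eta> > 0" "1 - \<delta> + \<eta> = \<beta> * real k"
    by (metis add_diff_cancel_left' diff_gt_0_iff_gt diff_add_cancel add.commute)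
  have \<delta>: "1 - \<delta> > 0" "\<delta> > 0" using assms by simp_all
  have "\<forall>\<^sub>F n::real in at_top. n \<ge> 1"
    by (rule eventually_ge_at_top)
  moreover have "\<forall>\<^sub>F n::real in at_top. 3 * n powr (1 - \<delta>) \<le> n / 1000"
    using \<delta> by real_asymp
  \<comment> \<open>The exponent is \<open>(n powr \<delta> / 2000 - 1) * (y / 2)\<close>, a lower
    bound for \<open>t * ln (1 + y)\<close>.\<close>
  moreover have "\<forall>\<^sub>F n::real in at_top. 60 * n powr (1 - \<delta>) < exp (n powr \<gamma> / 4000 - n powr (- \<beta>) / 2)"
    using \<delta> \<beta> \<gamma> by real_asymp
  moreover have "\<forall>\<^sub>F n::real in at_top. 60 * n powr (- \<eta>) < 1"
    using \<eta> by real_asymp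
  \<comment> \<open>The main term of \<open>(2 * t + 1) * 63 * p\<close> uses
    \<open>63 / 1000\<close> of the allowed \<open>129 / 1000\<close>; \<open>66 / 1000\<close> is
    left for the \<open>+ 1\<close>.\<close>
  moreover have "\<forall>\<^sub>F n::real in at_top. 63 * n powr (1 - \<delta>) < 66 / 1000 * n"
    using \<delta> by real_asymp
  ultimately show ?thesis
  proof eventually_elim
    case (elim n)
    define p y t where "p = n powr (1 - \<delta>)" and "y = n powr (- \<beta>)" and "t = nat \<lfloor>n powr \<delta> / 2000\<rfloor>"
    have n0: "n > 0" using elim by simp
    have y: "0 < y" "y \<le> 1"
      using elim(1) \<beta> powr_mono[of "- \<beta>" 0 n] unfolding y_def by auto
    have t: "real t \<le> n powr \<delta> / 2000" "n powr \<delta> / 2000 - 1 \<le> real t"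
    proof -
      have "n powr \<delta> / 2000 \<ge> 0" by simp
      then show "real t \<le> n powr \<delta> / 2000" "n powr \<delta> / 2000 - 1 \<le> real t"
        unfolding t_def by linarith+
    qed
    have "1 \<le> p" using elim(1) \<delta>(1) by (simp add: p_def ge_one_powr_ge_zero)
    moreover have "60 * p < (1 + y) ^ t"
    proof -
      have "n powr \<gamma> / 4000 - y / 2 = (n powr \<delta> / 2000 - 1) * (y / 2)"
        using n0 unfolding \<gamma>_def y_def by (simp add: powr_diff powr_minus field_simps)
      also have "\<dots> \<le> real t * ln (1 + y)"
      proof (cases "n powr \<delta> / 2000 - 1 \<ge> 0")
        case True
        have "exp (y / 2) \<le> 1 + y / 2 + (y / 2)\<^sup>2"
          using y by (intro exp_bound) auto
        also have "\<dots> \<le> 1 + y"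
        proof -
          have "(y / 2)\<^sup>2 = y * y / 4" by (simp add: power2_eq_square)
          moreover have "y * y \<le> y" using mult_left_mono[of y 1 y] y by simp
          ultimately show ?thesis using y by linarith
        qed
        finally have "y / 2 \<le> ln (1 + y)"
          using y by (subst ln_ge_iff) auto
        then show ?thesis using t(2) y True by (intro mult_mono) auto
      next
        case False
        then have "(n powr \<delta> / 2000 - 1) * (y / 2) \<le> 0" using y by (intro mult_nonpos_nonneg) auto
        also have "0 \<le> real t * ln (1 + y)" using y by simp
        finally show ?thesis .
      qed
      finally have "exp (n powr \<gamma> / 4000 - y / 2) \<le> exp (real t * ln (1 + y))" by simp
      also have "\<dots> = (1 + y) ^ t" using y by (simp add: exp_of_nat_mult)
      finally show ?thesis using elim(3) unfolding p_def y_def by linarith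
    qed
    moreover have "y ^ k * (60 * p) < 1"
    proof -
      have "y ^ k = n powr (- (\<beta> * real k))"
        using n0 unfolding y_def by (simp add: powr_powr flip: powr_realpow)
      then have "y ^ k * p = n powr (- \<eta>)"
        unfolding p_def \<eta>(2)[symmetric] by (simp flip: powr_add)
      then show ?thesis using elim(4) by simp
    qed
    moreover have "real (2 * t + 1) * (63 * p) < 129 / 1000 * n"
    proof -
      have "real (2 * t + 1) * (63 * p) \<le> (n powr \<delta> / 1000 + 1) * (63 * p)"
        using t(1) \<open>1 \<le> p\<close> by (intro mult_right_mono) auto
      also have "\<dots> = 63 / 1000 * (n powr \<delta> * p) + 63 * p" by (simp add: field_simps)
      also have "n powr \<delta> * p = n" using n0 unfolding p_def by (simp flip: powr_add)
      finally show ?thesis using elim(5) unfolding p_def by linarith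
    qed
    ultimately show ?case
      using y elim(2) unfolding p_def by blast
  qed
qed

section \<open>Translation to digraphs and the final bound\<close>

lemma triangle_free_graph_out_neighbours:
  assumes "pair_graph G" "triangle_free G"
  shows "triangle_free_graph (pverts G) (\<lambda>v. {w. (v, w) \<in> parcs G})"
proof -
  interpret pair_graph G by fact
  have sym: "(v, u) \<in> parcs G" if "(u, v) \<in> parcs G" for u v
    using pair_sym_arcs that by (auto simp: symmetric_def sym_def)
  show ?thesis
  proof
    show "finite (pverts G)" by (rule pair_finite_verts)
    show "{w. (v, w) \<in> parcs G} \<subseteq> pverts G" for v
      using in_arcsD2 by auto
    show "v \<in> {w. (u, w) \<in> parcs G}" if "u \<in> {w. (v, w) \<in> parcs G}" for u v
      using that sym by auto
    show "{w. (u, w) \<in> parcs G} \<inter> {w. (v, w) \<in> parcs G} = {}" if "v \<in> {w. (u, w) \<in> parcs G}" for u v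
      using that sym assms(2) unfolding triangle_free_def by blast
  qed
qed

lemma min_degree_le_card:
  assumes "pair_graph G" "v \<in> pverts G"
  shows "min_degree G \<le> card {w. (v, w) \<in> parcs G}"
proof -
  interpret pair_graph G by fact
  have "min_degree G \<le> out_degree (with_proj G) v"
    unfolding min_degree_def using assms(2) pair_finite_verts by (intro Min_le) auto
  also have "out_arcs (with_proj G) v = Pair v ` {w. (v, w) \<in> parcs G}"
    by (auto simp: out_arcs_def)
  then have "out_degree (with_proj G) v = card {w. (v, w) \<in> parcs G}"
    unfolding out_degree_def by (simp add: card_image inj_on_def)
  finally show ?thesis .
qed

theorem theorem1p5:
  fixes \<delta> \<epsilon> :: real
  assumes "0 < \<delta>" and "\<delta> < 1" and "0 < \<epsilon>"
  shows "\<exists>N::nat. \<forall>n \<ge> N. \<forall>G :: 'a pair_pre_digraph.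
    pair_graph G \<and> card (pverts G) = n \<and> triangle_free G \<and>
    real (min_degree G) \<ge> 1 / 3 * real n - real n powr (1 - \<delta>) \<longrightarrow>
    int (chromatic_number G) \<le> 10 ^ 391 + 1 + \<lceil>(1 + \<epsilon>) * (1 - \<delta>) / \<delta>\<rceil>"
proof -
  define k where "k = nat \<lceil>(1 + \<epsilon>) * (1 - \<delta>) / \<delta>\<rceil>"
  have "\<forall>\<^sub>F n in sequentially. 1 \<le> real n powr (1 - \<delta>) \<and> 3 * real n powr (1 - \<delta>) \<le> real n / 1000 \<and>
    (\<exists>t y. y > 0 \<and> 60 * real n powr (1 - \<delta>) < (1 + y) ^ t \<and> y ^ k * (60 * real n powr (1 - \<delta>)) < 1 \<and>
       real (2 * t + 1) * (63 * real n powr (1 - \<delta>)) < 129 / 1000 * real n)"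
    using eventually_compose_filterlim[OF eventually_parameters[OF assms] filterlim_real_sequentially]
    unfolding k_def .
  then obtain M where M: "1 \<le> real n powr (1 - \<delta>) \<and> 3 * real n powr (1 - \<delta>) \<le> real n / 1000 \<and>
    (\<exists>t y. y > 0 \<and> 60 * real n powr (1 - \<delta>) < (1 + y) ^ t \<and> y ^ k * (60 * real n powr (1 - \<delta>)) < 1 \<and>
       real (2 * t + 1) * (63 * real n powr (1 - \<delta>)) < 129 / 1000 * real n)" if "n \<ge> M" for n
    unfolding eventually_sequentially by blast
  show ?thesis
  proof (intro exI[of _ M] allI impI, elim conjE)
    fix n :: nat and G :: "'a pair_pre_digraph"
    assume "n \<ge> M" and G: "pair_graph G" "card (pverts G) = n" "triangle_free G"
      and min_deg: "1 / 3 * real n - real n powr (1 - \<delta>) \<le> real (min_degree G)"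
    interpret triangle_free_graph "pverts G" "\<lambda>v. {w. (v, w) \<in> parcs G}"
      using G(1,3) by (rule triangle_free_graph_out_neighbours)
    define p where "p = real n powr (1 - \<delta>)"
    obtain t y where p: "1 \<le> p" "3 * p \<le> real n / 1000"
      and y: "y > 0" "60 * p < (1 + y) ^ t" "y ^ k * (60 * p) < 1"
      and t: "real (2 * t + 1) * (63 * p) < 129 / 1000 * real n"
      using M[OF \<open>n \<ge> M\<close>] unfolding p_def by blast
    \<comment> \<open>The minimum degree itself might exceed \<open>n / 3\<close>. This smaller
      integer satisfies \<open>3 * d \<le> n\<close>, because \<open>p \<ge> 1\<close> absorbs the
      rounding, and still gives \<open>s \<le> 3 * p\<close>.\<close>
    define d where "d = nat \<lceil>real n / 3 - p\<rceil>"
    define s where "s = real n - 3 * real d"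
    have n0: "real n > 0" using p by linarith
    have "real_of_int \<lceil>real n / 3 - p\<rceil> \<le> real n / 3" "real n / 3 - p \<ge> 0"
      using p by linarith+
    then have d: "real d \<le> real n / 3" "real d \<ge> real n / 3 - p"
      unfolding d_def by linarith+
    then have s: "0 \<le> s" "s \<le> 3 * p" unfolding s_def by linarith+
    have "\<lceil>real n / 3 - p\<rceil> \<le> int (min_degree G)"
      using min_deg unfolding p_def by (simp add: ceiling_le_iff)
    then have "d \<le> min_degree G" unfolding d_def by linarith
    then have deg: "d \<le> card {w. (v, w) \<in> parcs G}" if "v \<in> pverts G" for v
      using min_degree_le_card[OF G(1) that] by linarith
    have "colourable (pverts G) (10 ^ 391 + 1 + k)"
    proof (rule colourable_of_min_degree[where d = d and n = "real n" and y = y and t = t])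
      have "20 * s \<le> 60 * p" using s by simp
      then show "20 * (real n - 3 * real d) < (1 + y) ^ t"
        using y(2) unfolding s_def by (rule le_less_trans)
      have "y ^ k * (20 * s) \<le> y ^ k * (60 * p)" using s y by (intro mult_left_mono) auto
      then show "y ^ k * (20 * (real n - 3 * real d)) < 1" using y(3) unfolding s_def by linarith
      have "real (2 * t + 1) * (21 * s) \<le> real (2 * t + 1) * (63 * p)"
        using s by (intro mult_left_mono) auto
      then show "real (2 * t + 1) * (21 * (real n - 3 * real d)) < 129 / 1000 * real n"
        using t unfolding s_def by linarith
    qed (use deg G d s p y n0 in \<open>auto simp: s_def\<close>)
    then obtain c where "proper_colouring G (10 ^ 391 + 1 + k) c"
      unfolding colourable_def proper_colouring_def
      by (metis G(1) mem_Collect_eq mem_N_in_V)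
    then have "chromatic_number G \<le> 10 ^ 391 + 1 + k"
      unfolding chromatic_number_def by (intro Least_le) blast
    then have "int (chromatic_number G) \<le> int (10 ^ 391 + 1 + k)"
      by (rule of_nat_mono)
    then have "int (chromatic_number G) \<le> 10 ^ 391 + 1 + int k"
      by simp
    moreover have "int k = \<lceil>(1 + \<epsilon>) * (1 - \<delta>) / \<delta>\<rceil>"
    proof -
      have "(1 + \<epsilon>) * (1 - \<delta>) / \<delta> \<ge> 0" using assms by simp
      then show ?thesis unfolding k_def by simp
    qed
    ultimately show "int (chromatic_number G) \<le> 10 ^ 391 + 1 + \<lceil>(1 + \<epsilon>) * (1 - \<delta>) / \<delta>\<rceil>"
      by simp
  qed
qed

end
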